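(* Let $n$ be a positive integer and $\zeta$ be a real transcendental number. Let $l\in\{1,2,\ldots,n\}$ be the smallest integer such that $w_{l}(\zeta)= w_{n}(\zeta)$. Then \[ \widehat{w}_{n}(\zeta)\leq \min \left\{n+l-1,\; \frac{n\,w_{n}(\zeta)}{w_{n}(\zeta)-l+1}+w_{n-l}(\zeta)\cdot \left(1-\frac{n}{w_{n}(\zeta)-l+1}\right)\right\}, \] where $w_{0}(\zeta)=0$, and where, if $w_{n}(\zeta)=\infty$, the second expression in the minimum is read as its limiting value $n+w_{n-l}(\zeta)$ (which is $+\infty$ if $w_{n-l}(\zeta)=\infty$).
   Context: For a polynomial $P\in\mathbb{Z}[T]$, let $H(P)$ denote its naive height, i.e. the maximum modulus among the coefficients of $P$. For a positive integer $n$ and a transcendental real number $\zeta$: - $w_{n}(\zeta)\in[0,\infty]$ is the supremum of the real numbers $w$ such that the system \[ H(P) \leq X, \qquad 0<\vert P(\zeta)\vert \leq X^{-w} \] has a solution $P\in\mathbb{Z}[T]$ of degree at most $n$ for arbitrarily large values of $X$. - $\widehat{w}_{n}(\zeta)$ is the supremum of the real numbers $w$ such that the same system has a solution $P\in\mathbb{Z}[T]$ of degree at most $n$ for all sufficiently large $X$. By convention $w_{0}(\zeta)=0$. The value $w_{n}(\zeta)=\infty$ is allowed. *)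

theory Defs
  imports
    "HOL-Analysis.Analysis"
    "HOL-Computational_Algebra.Polynomial"
begin

definition naive_height :: "int poly \<Rightarrow> int" where
  "naive_height P = Max ((\<lambda>i. \<bar>coeff P i\<bar>) ` {..degree P})"

definition approx_solvable :: "nat \<Rightarrow> real \<Rightarrow> real \<Rightarrow> real \<Rightarrow> bool" where
  "approx_solvable n \<zeta> w X \<longleftrightarrow>
     (\<exists>P :: int poly. degree P \<le> n \<and> real_of_int (naive_height P) \<le> X \<and>
        0 < \<bar>poly (map_poly real_of_int P) \<zeta>\<bar> \<and>
        \<bar>poly (map_poly real_of_int P) \<zeta>\<bar> \<le> X powr (- w))"

definition w_exp :: "nat \<Rightarrow> real \<Rightarrow> ereal" where
  "w_exp n \<zeta> = (if n = 0 then 0 else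
     Sup (ereal ` {w. \<exists>\<^sub>F X in at_top. approx_solvable n \<zeta> w X}))"

definition w_hat :: "nat \<Rightarrow> real \<Rightarrow> ereal" where
  "w_hat n \<zeta> = Sup (ereal ` {w. \<forall>\<^sub>F X in at_top. approx_solvable n \<zeta> w X})"

text \<open>
  The expression
  \<open>n w\<^sub>n / (w\<^sub>n - l + 1) + w\<^bsub>n-l\<^esub> (1 - n / (w\<^sub>n - l + 1))\<close>,
  replaced by its limiting value \<open>n + w\<^bsub>n-l\<^esub>\<close> when \<open>w\<^sub>n = \<infinity>\<close>.
  For transcendental \<open>\<zeta>\<close> and \<open>1 \<le> l \<le> n\<close> one has \<open>w\<^sub>n \<ge> n \<ge> l\<close> and
  \<open>w\<^bsub>n-l\<^esub> \<le> w\<^sub>n\<close>, so in the other case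
  every operand is finite, the denominators are positive, and the
  \<^typ>\<open>ereal\<close> operations agree with the real ones.
\<close>
definition second_bound :: "nat \<Rightarrow> nat \<Rightarrow> real \<Rightarrow> ereal" where
  "second_bound n l \<zeta> =
     (if w_exp n \<zeta> = \<infinity> then ereal (real n) + w_exp (n - l) \<zeta>
      else ereal (real n) * w_exp n \<zeta> / (w_exp n \<zeta> - ereal (real l) + 1)
           + w_exp (n - l) \<zeta> * (1 - ereal (real n) / (w_exp n \<zeta> - ereal (real l) + 1)))"

end

theory Submission
  imports Defs "Berlekamp_Zassenhaus.Factor_Bound" "HOL-Real_Asymp.Real_Asymp"
begin

text \<open>
  Write \<open>w = w\<^sub>n(\<zeta>)\<close>, let \<open>H\<close> be the naive height, and suppose that the system with exponent \<open>v\<close>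
  is solvable by polynomials of degree at most \<open>n\<close> for all large \<open>X\<close>; both bounds are bounds on \<open>v\<close>.
  The engine is a resultant estimate (\<open>resultant_lower_bound\<close>): if \<open>P\<close> is irreducible of degree
  between \<open>1\<close> and \<open>l\<close> and does not divide \<open>Q\<close>, where \<open>deg Q \<le> n\<close>, then
    \<open>1 \<le> C (H(P)\<^bsup>n-1\<^esup> H(Q)\<^bsup>l\<^esup> \<bar>P(\<zeta>)\<bar> + H(P)\<^bsup>n\<^esup> H(Q)\<^bsup>l-1\<^esup> \<bar>Q(\<zeta>)\<bar>)\<close>,
  because the resultant is a nonzero integer.  If \<open>Q = P R\<close> instead, Gelfond's inequality
  (\<open>gelfond\<close>) gives \<open>H(P) H(R) \<le> K H(Q)\<close>.

  Gelfond's inequality also shows that good approximations may be taken irreducible: an irreducible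
  factor inherits the quality of a product (\<open>irreducible_approximant\<close>).  As \<open>w\<^sub>l = w\<^sub>n\<close>, there are
  irreducible \<open>P\<close> of degree at most \<open>l\<close> and arbitrarily large height with \<open>\<bar>P(\<zeta>)\<bar>\<close> about
  \<open>H(P)\<^bsup>-w\<^esup>\<close>; as \<open>l\<close> is minimal, \<open>w\<^bsub>l-1\<^esub> < w\<^sub>l\<close>, and the degree of \<open>P\<close> is exactly \<open>l\<close>.

  For the first bound suppose \<open>v > n + l - 1\<close>.  As \<open>v \<le> w = w\<^sub>l\<close>, there is such a \<open>P\<close> with
  \<open>\<bar>P(\<zeta>)\<bar>\<close> much smaller than \<open>H(P)\<^bsup>-(n+l-1)\<^esup>\<close>.  With \<open>X = H(P) / (2 K)\<close> no multiple of \<open>P\<close> has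
  height at most \<open>X\<close>, so the solution \<open>Q\<close> for this \<open>X\<close> is not divisible by \<open>P\<close>, and both terms of the
  resultant estimate are too small.

  For the second bound write \<open>\<bar>P(\<zeta>)\<bar> = H(P)\<^bsup>-y\<^esup>\<close> with \<open>y\<close> near \<open>w\<close> (or \<open>y\<close> large, if \<open>w = \<infinity>\<close>), and
  take \<open>X = H(P)\<^bsup>\<theta>\<^esup>\<close> with \<open>\<theta>\<close> slightly below \<open>(y-l+1)/n\<close>.  When \<open>w > n + l - 1\<close>, the first term of the
  resultant estimate is then negligible, so a solution \<open>Q\<close> not divisible by \<open>P\<close> forces
  \<open>v \<le> l - 1 + n/\<theta>\<close>.  A solution \<open>Q = P R\<close> has \<open>deg R \<le> n - l\<close> and \<open>H(R)\<close> at most about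
  \<open>H(P)\<^bsup>\<theta>-1\<^esup>\<close>, so \<open>\<bar>R(\<zeta>)\<bar>\<close> is bounded below through \<open>w\<^bsub>n-l\<^esub>\<close>, and
  \<open>v \<le> y/\<theta> + w\<^bsub>n-l\<^esub> (1 - 1/\<theta>)\<close>.  In the limit the second of these two bounds is the larger one and
  is the claimed expression.  When \<open>w \<le> n + l - 1\<close>, the claim already follows from \<open>v \<le> w\<close>.
\<close>

hide_const (open) up_ring.coeff up_ring.monom module.smult

section \<open>Heights and values of integer polynomials\<close>

abbreviation ht :: "int poly \<Rightarrow> real" where
  "ht P \<equiv> real_of_int (naive_height P)"

abbreviation ev :: "real \<Rightarrow> int poly \<Rightarrow> real" where
  "ev \<zeta> P \<equiv> poly (map_poly real_of_int P) \<zeta>"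

lemma abs_coeff_le_ht: "\<bar>real_of_int (coeff P i)\<bar> \<le> ht P"
proof (cases "i \<le> degree P")
  case True
  then have "\<bar>coeff P i\<bar> \<le> naive_height P"
    unfolding naive_height_def by (intro Max_ge) auto
  then show ?thesis by linarith
next
  case False
  then have "coeff P i = 0" by (simp add: coeff_eq_0)
  moreover have "\<bar>coeff P 0\<bar> \<le> naive_height P"
    unfolding naive_height_def by (intro Max_ge) auto
  ultimately show ?thesis by auto
qed

lemma ht_attained: "\<exists>i. ht P = \<bar>real_of_int (coeff P i)\<bar>"
proof -
  have "naive_height P \<in> (\<lambda>i. \<bar>coeff P i\<bar>) ` {..degree P}"
    unfolding naive_height_def by (intro Max_in) auto
  then show ?thesis by (auto simp flip: of_int_abs)
qed

lemma naive_height_nonneg [simp]: "0 \<le> naive_height P"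
  using ht_attained[of P] by linarith

lemma ht_ge_1:
  assumes "P \<noteq> 0"
  shows "1 \<le> ht P"
proof -
  have "coeff P (degree P) \<noteq> 0" using assms by simp
  then have "1 \<le> \<bar>real_of_int (coeff P (degree P))\<bar>" by linarith
  then show ?thesis using abs_coeff_le_ht[of P "degree P"] by linarith
qed

lemma ev_mult: "ev \<zeta> (P * Q) = ev \<zeta> P * ev \<zeta> Q"
  by (simp add: of_int_poly_hom.hom_mult)

lemma ev_eq_sum:
  assumes "degree P < N"
  shows "ev \<zeta> P = (\<Sum>j<N. of_int (coeff P j) * \<zeta> ^ j)"
proof -
  have "ev \<zeta> P = (\<Sum>j\<le>degree P. of_int (coeff P j) * \<zeta> ^ j)"
    by (simp add: poly_altdef)
  also have "\<dots> = (\<Sum>j<N. of_int (coeff P j) * \<zeta> ^ j)"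
    using assms by (intro sum.mono_neutral_left) (auto simp: coeff_eq_0)
  finally show ?thesis .
qed

lemma ev_nonzero:
  assumes "\<not> algebraic \<zeta>" "P \<noteq> 0"
  shows "ev \<zeta> P \<noteq> 0"
  using assms algebraicI[of "map_poly real_of_int P" \<zeta>] by auto

lemma ev_const: "ev \<zeta> [:a:] = of_int a"
  by (cases "a = 0") auto

lemma abs_ev_ge_1_if_const:
  assumes "degree P = 0" "P \<noteq> 0"
  shows "1 \<le> \<bar>ev \<zeta> P\<bar>"
proof -
  obtain a where a: "P = [:a:]" using assms(1) by (rule degree_eq_zeroE)
  with assms(2) have "a \<noteq> 0" by simp
  then show ?thesis using a by (simp add: ev_const)
qed

section \<open>Gelfond's inequality\<close>

definition gelfond_const :: "nat \<Rightarrow> real" where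
  "gelfond_const n = 4 ^ n * real (n + 1)"

lemma gelfond_const_ge_1: "1 \<le> gelfond_const n"
proof -
  have "1 * 1 \<le> (4::real) ^ n * real (n + 1)" by (intro mult_mono) auto
  then show ?thesis unfolding gelfond_const_def by linarith
qed

lemma ht_le_mahler: "ht P \<le> 2 ^ degree P * mahler_measure P"
proof -
  obtain i where i: "ht P = \<bar>real_of_int (coeff P i)\<bar>" using ht_attained by blast
  have "real (degree P choose i) \<le> 2 ^ degree P"
    using binomial_le_pow2[of "degree P" i] of_nat_le_iff[of "degree P choose i" "2 ^ degree P", where ?'a = real]
    by simp
  then have "real (degree P choose i) * mahler_measure P \<le> 2 ^ degree P * mahler_measure P"
    by (intro mult_right_mono mahler_measure_ge_0)
  then show ?thesis using Mignotte_bound[of P i] i by simp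
qed

lemma mahler_le_ht: "mahler_measure P \<le> real (degree P + 1) * ht P"
proof -
  have "(\<Sum>a\<leftarrow>coeffs P. a * a) \<le> (\<Sum>a\<leftarrow>coeffs P. (naive_height P)\<^sup>2)"
  proof (rule sum_list_mono)
    fix a assume "a \<in> set (coeffs P)"
    then obtain i where "a = coeff P i" by (auto simp: coeffs_def split: if_splits)
    then have "real_of_int \<bar>a\<bar> \<le> ht P" using abs_coeff_le_ht[of P i] by simp
    then have "\<bar>a\<bar> \<le> naive_height P" by simp
    then have "\<bar>a\<bar>\<^sup>2 \<le> (naive_height P)\<^sup>2" by (intro power_mono) auto
    then show "a * a \<le> (naive_height P)\<^sup>2" by (simp add: power2_eq_square)
  qed
  also have "\<dots> = int (length (coeffs P)) * (naive_height P)\<^sup>2"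
    by (simp add: sum_list_triv)
  also have "\<dots> \<le> int (degree P + 1) * (naive_height P)\<^sup>2"
    by (intro mult_right_mono) (auto simp: length_coeffs_degree coeffs_def)
  also have "\<dots> \<le> (int (degree P + 1))\<^sup>2 * (naive_height P)\<^sup>2"
    by (intro mult_right_mono self_le_power) auto
  finally have "real_of_int (\<Sum>a\<leftarrow>coeffs P. a * a) \<le> (real (degree P + 1) * ht P)\<^sup>2"
    by (metis (mono_tags, lifting) of_int_le_iff of_int_mult of_int_of_nat_eq of_int_power power_mult_distrib)
  then have "sqrt (real_of_int (\<Sum>a\<leftarrow>coeffs P. a * a)) \<le> real (degree P + 1) * ht P"
    by (intro real_le_lsqrt mult_nonneg_nonneg) auto
  then show ?thesis using Landau_inequality_mahler_measure[of P] by linarith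
qed

text \<open>
  The height and the Mahler measure agree up to factors depending only on the degree, and the Mahler
  measure is multiplicative.
\<close>

lemma gelfond:
  assumes "degree (A * B) \<le> n"
  shows "ht A * ht B \<le> gelfond_const n * ht (A * B)"
proof (cases "A = 0 \<or> B = 0")
  case True
  then show ?thesis by (auto simp: naive_height_def)
next
  case False
  then have d: "degree A + degree B = degree (A * B)" by (simp add: degree_mult_eq)
  have M: "mahler_measure (A * B) = mahler_measure A * mahler_measure B"
    by (simp add: mahler_measure_def of_int_poly_hom.hom_mult measure_eq_prod)
  have "ht A * ht B \<le> (2 ^ degree A * mahler_measure A) * (2 ^ degree B * mahler_measure B)"
    by (intro mult_mono ht_le_mahler) (auto simp: mahler_measure_ge_0)
  also have "\<dots> = 2 ^ degree (A * B) * mahler_measure (A * B)"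
    unfolding M d[symmetric] by (simp add: power_add)
  also have "\<dots> \<le> 4 ^ n * (real (n + 1) * ht (A * B))"
  proof (intro mult_mono)
    have "(2::real) ^ degree (A * B) \<le> 4 ^ degree (A * B)" by (intro power_mono) auto
    also have "\<dots> \<le> 4 ^ n" using assms by (intro power_increasing) auto
    finally show "(2::real) ^ degree (A * B) \<le> 4 ^ n" .
    have "real (degree (A * B) + 1) * ht (A * B) \<le> real (n + 1) * ht (A * B)"
      using assms by (intro mult_right_mono) auto
    then show "mahler_measure (A * B) \<le> real (n + 1) * ht (A * B)"
      using mahler_le_ht[of "A * B"] by linarith
  qed (auto simp: mahler_measure_ge_0)
  finally show ?thesis by (simp add: gelfond_const_def mult_ac)
qed

section \<open>The resultant estimate\<close>

text \<open>
  The coefficient matrix of the \<open>f i\<close> has a nonzero integer determinant.  Adding \<open>\<zeta>\<^sup>j\<close> times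
  column \<open>j\<close> to column \<open>0\<close>, for all \<open>j \<ge> 1\<close>, keeps the determinant and turns column \<open>0\<close> into the
  values at \<open>\<zeta>\<close>; every term of the Leibniz expansion then contains one value and, from each of the
  other rows, a coefficient.
\<close>

lemma independent_polys_lower_bound:
  fixes f :: "nat \<Rightarrow> int poly"
  assumes "N \<ge> 1"
    and deg: "\<And>i. i < N \<Longrightarrow> degree (f i) < N"
    and indep: "\<And>c. (\<Sum>i<N. smult (c i) (f i)) = 0 \<Longrightarrow> \<forall>i<N. c i = 0"
  shows "1 \<le> fact N * (\<Sum>i<N. \<bar>ev \<zeta> (f i)\<bar> * (\<Prod>j\<in>{..<N} - {i}. ht (f j)))"
proof -
  define S where "S = (\<Sum>i<N. \<bar>ev \<zeta> (f i)\<bar> * (\<Prod>j\<in>{..<N} - {i}. ht (f j)))"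
  define A :: "int mat" where "A = mat N N (\<lambda>(i, j). coeff (f i) j)"
  \<comment> \<open>multiplication by \<open>E\<close> from the right performs the column operation\<close>
  define E :: "real mat" where
    "E = mat N N (\<lambda>(i, j). if j = 0 then \<zeta> ^ i else if i = j then 1 else 0)"
  define B where "B = map_mat real_of_int A * E"
  have cA: "A \<in> carrier_mat N N" and cE: "E \<in> carrier_mat N N" and cB: "B \<in> carrier_mat N N"
    by (auto simp: A_def E_def B_def)
  have "det A \<noteq> 0"
  proof
    assume "det A = 0"
    then have "det (transpose_mat A) = 0" using det_transpose[OF cA] by simp
    then obtain c where c: "c \<in> carrier_vec N" "c \<noteq> 0\<^sub>v N" "transpose_mat A *\<^sub>v c = 0\<^sub>v N"
      using det_0_iff_vec_prod_zero[of "transpose_mat A" N] cA by auto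
    have "(\<Sum>i<N. smult (vec_index c i) (f i)) = 0"
    proof (rule poly_eqI)
      fix j
      show "coeff (\<Sum>i<N. smult (vec_index c i) (f i)) j = coeff 0 j"
      proof (cases "j < N")
        case True
        have "vec_index (transpose_mat A *\<^sub>v c) j = (\<Sum>i<N. coeff (f i) j * vec_index c i)"
          using True c(1) by (simp add: A_def scalar_prod_def atLeast0LessThan)
        with c(3) True show ?thesis by (simp add: coeff_sum mult.commute)
      next
        case False
        then have "coeff (f i) j = 0" if "i < N" for i
          using deg[OF that] by (intro coeff_eq_0) auto
        then show ?thesis by (simp add: coeff_sum)
      qed
    qed
    from indep[OF this] have "c = 0\<^sub>v N" using c(1) by (intro eq_vecI) auto
    with c(2) show False by contradiction
  qed
  have "det E = 1"
  proof -
    have "det E = prod_list (diag_mat E)"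
      by (rule det_lower_triangular[OF _ cE]) (auto simp: E_def)
    also have "\<dots> = (\<Prod>i\<in>{0..<N}. E $$ (i, i))"
      using cE by (simp add: prod_list_diag_prod)
    also have "\<dots> = 1" by (intro prod.neutral) (auto simp: E_def)
    finally show ?thesis .
  qed
  then have "det B = real_of_int (det A)"
    using cA cE by (simp add: B_def det_mult[of _ N] of_int_hom.hom_det)
  then have "1 \<le> \<bar>det B\<bar>" using \<open>det A \<noteq> 0\<close> by simp
  have B0: "B $$ (i, 0) = ev \<zeta> (f i)" if "i < N" for i
    using that assms(1) ev_eq_sum[OF deg[OF that], of \<zeta>]
    by (simp add: B_def A_def E_def scalar_prod_def atLeast0LessThan)
  have Bj: "B $$ (i, j) = coeff (f i) j" if "i < N" "j < N" "j \<noteq> 0" for i j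
    using that by (simp add: B_def A_def E_def scalar_prod_def atLeast0LessThan
        if_distrib[of "\<lambda>x. _ * x"] sum.delta' cong: if_cong)
  have perm_term: "\<bar>\<Prod>i = 0..<N. B $$ (i, p i)\<bar> \<le> S" if p: "p permutes {0..<N}" for p
  proof -
    have "0 \<in> p ` {0..<N}" using permutes_image[OF p] assms(1) by simp
    then obtain i0 where i0: "i0 < N" "p i0 = 0" by auto
    have "\<bar>\<Prod>i = 0..<N. B $$ (i, p i)\<bar> = \<bar>B $$ (i0, p i0)\<bar> * (\<Prod>i\<in>{0..<N} - {i0}. \<bar>B $$ (i, p i)\<bar>)"
      using i0(1) by (simp add: abs_prod abs_mult prod.remove[of _ i0])
    also have "\<dots> \<le> \<bar>ev \<zeta> (f i0)\<bar> * (\<Prod>j\<in>{0..<N} - {i0}. ht (f j))"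
    proof (intro mult_mono prod_mono conjI)
      fix i assume i: "i \<in> {0..<N} - {i0}"
      then have "p i < N" using permutes_in_image[OF p, of i] by simp
      moreover have "p i \<noteq> 0"
        using i i0(2) inj_eq[OF permutes_inj[OF p], of i i0] by simp
      ultimately
      show "\<bar>B $$ (i, p i)\<bar> \<le> ht (f i)"
        using i Bj[of i "p i"] abs_coeff_le_ht by auto
    qed (use i0 B0 in \<open>auto intro: prod_nonneg\<close>)
    also have "\<dots> \<le> S"
      unfolding S_def atLeast0LessThan
      by (rule member_le_sum) (use i0 in \<open>auto intro!: mult_nonneg_nonneg prod_nonneg\<close>)
    finally show ?thesis .
  qed
  have "\<bar>det B\<bar> \<le> (\<Sum>p\<in>{p. p permutes {0..<N}}. \<bar>signof p * (\<Prod>i = 0..<N. B $$ (i, p i))\<bar>)"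
    unfolding det_def'[OF cB] by (rule sum_abs)
  also have "\<dots> \<le> (\<Sum>p\<in>{p. p permutes {0..<N}}. S)"
    by (intro sum_mono) (use perm_term in \<open>auto simp: abs_mult sign_def\<close>)
  also have "\<dots> = fact N * S"
    by (simp add: card_permutations[of "{0..<N}" N])
  finally show ?thesis using \<open>1 \<le> \<bar>det B\<bar>\<close> unfolding S_def by linarith
qed

lemma sum_lessThan_add:
  fixes g :: "nat \<Rightarrow> 'a :: comm_monoid_add"
  shows "(\<Sum>i<n + m. g i) = (\<Sum>i<n. g i) + (\<Sum>j<m. g (n + j))"
  by (induction m) (simp_all add: add.assoc)

lemma naive_height_monom_mult_le: "naive_height (monom 1 k * P) \<le> naive_height P"
proof -
  obtain i where "ht (monom 1 k * P) = \<bar>real_of_int (coeff (monom 1 k * P) i)\<bar>"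
    using ht_attained by blast
  moreover have "\<bar>real_of_int (coeff (monom 1 k * P) i)\<bar> \<le> ht P"
    using abs_coeff_le_ht[of P "i - k"] by (simp add: coeff_monom_mult)
  ultimately show ?thesis by linarith
qed

text \<open>
  This is the linear independence of shifts \<open>T\<^sup>i P\<close> and of the shifts \<open>T\<^sup>j Q\<close> with \<open>j < deg P\<close>, the
  rows of a Sylvester matrix: since \<open>P\<close> is prime, it would have to divide \<open>V\<close>, whose degree is too
  small.
\<close>

lemma shifts_independent:
  fixes P Q :: "int poly"
  assumes "irreducible P" "\<not> P dvd Q"
    and "U * P + V * Q = 0" "degree V < degree P"
  shows "U = 0 \<and> V = 0"
proof -
  have "P \<noteq> 0" using assms(1) by auto
  have "P dvd V * Q" using assms(3) by (metis add_eq_0_iff dvd_minus_iff dvd_triv_right)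
  then have "P dvd V"
    using assms(1,2) by (metis irreducible_imp_prime_elem prime_elem_dvd_mult_iff)
  then have "V = 0" using assms(4) dvd_imp_degree_le by (metis not_less)
  moreover from this assms(3) \<open>P \<noteq> 0\<close> have "U = 0" by simp
  ultimately show ?thesis by simp
qed

text \<open>
  The rows are the \<open>n\<close> shifts of \<open>P\<close> and the \<open>deg P\<close> shifts of \<open>Q\<close>.  Using \<open>n\<close> shifts of \<open>P\<close>
  rather than \<open>deg Q\<close> treats all \<open>Q\<close> of degree at most \<open>n\<close> alike, constants included.
\<close>

lemma resultant_lower_bound_exact:
  fixes P Q :: "int poly"
  assumes irr: "irreducible P" and "degree P \<ge> 1" and "Q \<noteq> 0" "degree Q \<le> n" "n \<ge> 1"
    and ndvd: "\<not> P dvd Q"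
  shows "1 \<le> fact (n + degree P) * real (n + degree P) * max 1 \<bar>\<zeta>\<bar> ^ (n + degree P) *
    (\<bar>ev \<zeta> P\<bar> * ht P ^ (n - 1) * ht Q ^ degree P + \<bar>ev \<zeta> Q\<bar> * ht P ^ n * ht Q ^ (degree P - 1))"
proof -
  define m where "m = degree P"
  have m: "m \<ge> 1" using assms(2) by (simp add: m_def)
  define f where "f i = (if i < n then monom 1 i * P else monom 1 (i - n) * Q)" for i
  define T where "T = \<bar>ev \<zeta> P\<bar> * ht P ^ (n - 1) * ht Q ^ m + \<bar>ev \<zeta> Q\<bar> * ht P ^ n * ht Q ^ (m - 1)"
  define Z where "Z = max 1 \<bar>\<zeta>\<bar> ^ (n + m)"
  have P0: "P \<noteq> 0" using irr by auto
  have hP: "1 \<le> ht P" and hQ: "1 \<le> ht Q" using P0 assms(3) ht_ge_1 by blast+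
  have deg: "degree (f i) < n + m" if "i < n + m" for i
    using that assms(3,4) P0 m_def
    by (auto simp: f_def degree_mult_eq degree_monom_eq)
  have indep: "\<forall>i<n+m. c i = 0" if c: "(\<Sum>i<n + m. smult (c i) (f i)) = 0" for c
  proof -
    define U where "U = (\<Sum>i<n. monom (c i) i)"
    define V where "V = (\<Sum>j<m. monom (c (n + j)) j)"
    have "U * P + V * Q = (\<Sum>i<n + m. smult (c i) (f i))"
      unfolding sum_lessThan_add U_def V_def sum_distrib_right
      by (simp add: f_def smult_monom flip: mult_smult_left)
    also note c
    finally have UV: "U * P + V * Q = 0" .
    have "degree V < m"
    proof -
      have "degree (monom (c (n + j)) j) \<le> m - 1" if "j < m" for j
        using that degree_monom_le[of "c (n + j)" j] by linarith
      then have "degree V \<le> m - 1"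
        unfolding V_def by (intro degree_sum_le) auto
      then show ?thesis using m by linarith
    qed
    then have "U = 0" "V = 0"
      using shifts_independent[OF irr ndvd UV] by (simp_all add: m_def)
    have cU: "coeff U i = c i" if "i < n" for i
      using that by (simp add: U_def coeff_sum)
    have cV: "coeff V j = c (n + j)" if "j < m" for j
      using that by (simp add: V_def coeff_sum)
    show ?thesis
    proof (intro allI impI)
      fix i assume "i < n + m"
      show "c i = 0"
      proof (cases "i < n")
        case True
        then show ?thesis using cU[of i] \<open>U = 0\<close> by simp
      next
        case False
        then show ?thesis using cV[of "i - n"] \<open>V = 0\<close> \<open>i < n + m\<close> by simp
      qed
    qed
  qed
  \<comment> \<open>\<open>g j\<close> bounds the height of row \<open>j\<close> and is never zero, so one factor can be divided out\<close>
  define g where "g j = (if j < n then ht P else ht Q)" for j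
  have g1: "1 \<le> g j" for j using hP hQ by (simp add: g_def)
  have prod_g: "(\<Prod>j<n + m. g j) = ht P ^ n * ht Q ^ m"
  proof -
    have "(\<Prod>j<n + k. g j) = ht P ^ n * ht Q ^ k" for k
      by (induction k) (auto simp: g_def)
    then show ?thesis .
  qed
  have row: "\<bar>ev \<zeta> (f i)\<bar> * (\<Prod>j\<in>{..<n+m} - {i}. ht (f j)) \<le> Z * T" if i: "i < n + m" for i
  proof -
    have "g i * (\<Prod>j\<in>{..<n+m} - {i}. ht (f j)) \<le> g i * (\<Prod>j\<in>{..<n+m} - {i}. g j)"
      using g1[of i]
      by (intro mult_left_mono prod_mono) (auto simp: f_def g_def naive_height_monom_mult_le)
    also have "g i * (\<Prod>j\<in>{..<n+m} - {i}. g j) = ht P ^ n * ht Q ^ m"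
      using i prod_g by (simp add: prod.remove[of "{..<n+m}" i])
    finally have pr: "(\<Prod>j\<in>{..<n+m} - {i}. ht (f j)) \<le> ht P ^ n * ht Q ^ m / g i"
      using g1[of i] by (simp add: field_simps)
    have z: "\<bar>\<zeta>\<bar> ^ k \<le> Z" if "k < n + m" for k
    proof -
      have "\<bar>\<zeta>\<bar> ^ k \<le> max 1 \<bar>\<zeta>\<bar> ^ k" by (intro power_mono) auto
      also have "\<dots> \<le> Z" unfolding Z_def using that by (intro power_increasing) auto
      finally show ?thesis .
    qed
    have Zn: "0 \<le> Z" by (simp add: Z_def)
    show ?thesis
    proof (cases "i < n")
      case True
      have "\<bar>ev \<zeta> (f i)\<bar> = \<bar>\<zeta>\<bar> ^ i * \<bar>ev \<zeta> P\<bar>"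
        using True by (simp add: f_def ev_mult abs_mult power_abs poly_monom map_poly_monom)
      moreover have "ht P ^ n * ht Q ^ m / g i = ht P ^ (n - 1) * ht Q ^ m"
        using True hP \<open>n \<ge> 1\<close> by (simp add: g_def power_eq_if)
      ultimately have "\<bar>ev \<zeta> (f i)\<bar> * (\<Prod>j\<in>{..<n+m} - {i}. ht (f j))
          \<le> (Z * \<bar>ev \<zeta> P\<bar>) * (ht P ^ (n - 1) * ht Q ^ m)"
        using pr z[OF i] by (auto intro!: mult_mono prod_nonneg simp: Zn)
      also have "\<dots> \<le> Z * T"
        using Zn by (auto simp: T_def distrib_left mult.assoc)
      finally show ?thesis .
    next
      case False
      have "\<bar>ev \<zeta> (f i)\<bar> = \<bar>\<zeta>\<bar> ^ (i - n) * \<bar>ev \<zeta> Q\<bar>"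
        using False by (simp add: f_def ev_mult abs_mult power_abs poly_monom map_poly_monom)
      moreover have "ht P ^ n * ht Q ^ m / g i = ht P ^ n * ht Q ^ (m - 1)"
        using False hQ m by (simp add: g_def power_eq_if)
      ultimately have "\<bar>ev \<zeta> (f i)\<bar> * (\<Prod>j\<in>{..<n+m} - {i}. ht (f j))
          \<le> (Z * \<bar>ev \<zeta> Q\<bar>) * (ht P ^ n * ht Q ^ (m - 1))"
        using pr z[of "i - n"] i by (auto intro!: mult_mono prod_nonneg simp: Zn)
      also have "\<dots> \<le> Z * T"
        using Zn by (auto simp: T_def distrib_left mult.assoc)
      finally show ?thesis .
    qed
  qed
  have "1 \<le> fact (n + m) * (\<Sum>i<n + m. \<bar>ev \<zeta> (f i)\<bar> * (\<Prod>j\<in>{..<n + m} - {i}. ht (f j)))"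
    by (rule independent_polys_lower_bound) (use deg indep \<open>n \<ge> 1\<close> in auto)
  also have "\<dots> \<le> fact (n + m) * (\<Sum>i<n + m. Z * T)"
    using row by (intro mult_left_mono sum_mono) auto
  also have "\<dots> = fact (n + m) * real (n + m) * Z * T" by simp
  finally show ?thesis by (simp add: Z_def T_def m_def)
qed

lemma resultant_lower_bound:
  assumes "n \<ge> 1"
  obtains C where "C > 0"
    "\<And>P Q. irreducible P \<Longrightarrow> 1 \<le> degree P \<Longrightarrow> degree P \<le> l \<Longrightarrow> Q \<noteq> 0 \<Longrightarrow> degree Q \<le> n \<Longrightarrow>
       \<not> P dvd Q \<Longrightarrow>
       1 \<le> C * (\<bar>ev \<zeta> P\<bar> * ht P ^ (n - 1) * ht Q ^ l + \<bar>ev \<zeta> Q\<bar> * ht P ^ n * ht Q ^ (l - 1))"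
proof
  let ?C = "\<lambda>k. fact (n + k) * real (n + k) * max 1 \<bar>\<zeta>\<bar> ^ (n + k)"
  show "?C l > 0" using assms by simp
  fix P Q :: "int poly"
  assume *: "irreducible P" "1 \<le> degree P" "degree P \<le> l" "Q \<noteq> 0" "degree Q \<le> n" "\<not> P dvd Q"
  have h: "1 \<le> ht Q" "0 \<le> ht P" using * ht_ge_1[of Q] by auto
  let ?T = "\<lambda>k. \<bar>ev \<zeta> P\<bar> * ht P ^ (n - 1) * ht Q ^ k + \<bar>ev \<zeta> Q\<bar> * ht P ^ n * ht Q ^ (k - 1)"
  have "1 \<le> ?C (degree P) * ?T (degree P)"
    by (rule resultant_lower_bound_exact[OF *(1,2,4,5) assms *(6)])
  also have "\<dots> \<le> ?C l * ?T l"
  proof (rule mult_mono)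
    show "?C (degree P) \<le> ?C l"
      using *(3) by (intro mult_mono power_increasing fact_mono) auto
    show "?T (degree P) \<le> ?T l"
      using *(3) h by (intro add_mono mult_left_mono power_increasing) auto
  qed (use h in auto)
  finally show "1 \<le> ?C l * ?T l" .
qed

section \<open>Lower bounds for values and the exponents\<close>

text \<open>
  The bound holds with a multiplicative constant for all heights, so that it can be multiplied over
  factorisations.  Up to the boundary value of \<open>w\<close> it says that \<open>w\<^sub>n(\<zeta>) \<le> w\<close>.
\<close>

definition order_at_most :: "real \<Rightarrow> nat \<Rightarrow> real \<Rightarrow> bool" where
  "order_at_most \<zeta> n w \<longleftrightarrow>
     (\<exists>c>0. \<forall>P. P \<noteq> 0 \<longrightarrow> degree P \<le> n \<longrightarrow> c * ht P powr (- w) \<le> \<bar>ev \<zeta> P\<bar>)"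

lemma order_at_mostE:
  assumes "order_at_most \<zeta> n w"
  obtains c where "c > 0" "\<And>P. P \<noteq> 0 \<Longrightarrow> degree P \<le> n \<Longrightarrow> c * ht P powr (- w) \<le> \<bar>ev \<zeta> P\<bar>"
  using assms unfolding order_at_most_def by blast

lemma order_at_most_0:
  assumes "0 \<le> w"
  shows "order_at_most \<zeta> 0 w"
  unfolding order_at_most_def
proof (intro exI[of _ 1] conjI allI impI)
  fix P :: "int poly" assume P: "P \<noteq> 0" "degree P \<le> 0"
  have "ht P powr (- w) \<le> 1 powr (- w)"
    using assms ht_ge_1[OF P(1)] by (intro powr_mono2') auto
  then show "1 * ht P powr (- w) \<le> \<bar>ev \<zeta> P\<bar>"
    using abs_ev_ge_1_if_const[of P \<zeta>] P by simp
qed auto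

lemma approx_solvable_iff:
  "approx_solvable n \<zeta> w X \<longleftrightarrow>
     (\<exists>P. degree P \<le> n \<and> ht P \<le> X \<and> ev \<zeta> P \<noteq> 0 \<and> \<bar>ev \<zeta> P\<bar> \<le> X powr (- w))"
  by (simp add: approx_solvable_def)

lemma powr_eventually_less:
  fixes a b C :: real
  assumes "a < b"
  shows "\<forall>\<^sub>F X in at_top. C * X powr a < X powr b"
proof -
  have "filterlim (\<lambda>X. X powr (b - a)) at_top at_top"
    using assms by real_asymp
  then have "\<forall>\<^sub>F X in at_top. C < X powr (b - a)"
    by (simp add: filterlim_at_top_dense)
  then show ?thesis
    using eventually_gt_at_top[of 0]
  proof eventually_elim
    case (elim X)
    then have "C * X powr a < X powr (b - a) * X powr a" by (intro mult_strict_right_mono) auto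
    then show ?case by (simp flip: powr_add)
  qed
qed

lemma w_exp_le_if_order_at_most:
  assumes "0 \<le> w" "order_at_most \<zeta> n w"
  shows "w_exp n \<zeta> \<le> ereal w"
proof (cases "n = 0")
  case True
  then show ?thesis using assms(1) by (simp add: w_exp_def)
next
  case False
  obtain c where c: "c > 0" "\<And>P. P \<noteq> 0 \<Longrightarrow> degree P \<le> n \<Longrightarrow> c * ht P powr (- w) \<le> \<bar>ev \<zeta> P\<bar>"
    using assms(2) by (rule order_at_mostE) blast
  have "v \<le> w" if v: "\<exists>\<^sub>F X in at_top. approx_solvable n \<zeta> v X" for v
  proof (rule ccontr)
    assume "\<not> v \<le> w"
    then have "\<forall>\<^sub>F X in at_top. 1 / c * X powr (- v) < X powr (- w)"
      by (intro powr_eventually_less) auto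
    from frequently_eventually_frequently[OF v this]
    obtain X where X: "approx_solvable n \<zeta> v X" "1 / c * X powr (- v) < X powr (- w)"
      by (auto dest: frequently_ex)
    from X(1) obtain P where P: "degree P \<le> n" "ht P \<le> X" "ev \<zeta> P \<noteq> 0" "\<bar>ev \<zeta> P\<bar> \<le> X powr (- v)"
      by (auto simp: approx_solvable_iff)
    then have "P \<noteq> 0" by auto
    have "c * X powr (- w) \<le> c * ht P powr (- w)"
      using assms(1) c(1) P(2) ht_ge_1[OF \<open>P \<noteq> 0\<close>] by (intro mult_left_mono powr_mono2') auto
    also have "\<dots> \<le> X powr (- v)" using c(2)[OF \<open>P \<noteq> 0\<close> P(1)] P(4) by linarith
    finally show False using X(2) c(1) by (simp add: field_simps)
  qed
  then show ?thesis using False by (auto simp: w_exp_def intro!: Sup_least)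
qed

text \<open>
  There is \<open>X1 \<ge> 1\<close> such that no \<open>X \<ge> X1\<close> admits a solution; testing \<open>P\<close> at \<open>X = X1 H(P)\<close>
  covers all heights at once, with constant \<open>X1\<^bsup>-w\<^esup>\<close>.
\<close>

lemma order_at_most_if_w_exp_less:
  assumes "\<not> algebraic \<zeta>" "0 \<le> w" "w_exp n \<zeta> < ereal w"
  shows "order_at_most \<zeta> n w"
proof (cases "n = 0")
  case True
  then show ?thesis using assms(2) order_at_most_0 by simp
next
  case False
  have "\<not> (\<exists>\<^sub>F X in at_top. approx_solvable n \<zeta> w X)"
  proof
    assume "\<exists>\<^sub>F X in at_top. approx_solvable n \<zeta> w X"
    then have "ereal w \<le> w_exp n \<zeta>"
      using False by (auto simp: w_exp_def intro!: Sup_upper)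
    with assms(3) show False by simp
  qed
  then obtain X0 where X0: "\<And>X. X \<ge> X0 \<Longrightarrow> \<not> approx_solvable n \<zeta> w X"
    by (auto simp: not_frequently eventually_at_top_linorder)
  define X1 where "X1 = max 1 X0"
  have "X1 powr (- w) * ht P powr (- w) \<le> \<bar>ev \<zeta> P\<bar>" if P: "P \<noteq> 0" "degree P \<le> n" for P
  proof -
    have h: "1 \<le> ht P" "1 \<le> X1" using ht_ge_1[OF P(1)] by (auto simp: X1_def)
    then have "X1 * 1 \<le> X1 * ht P" "1 * ht P \<le> X1 * ht P"
      by (intro mult_left_mono mult_right_mono; simp)+
    then have "X0 \<le> X1 * ht P" "ht P \<le> X1 * ht P" by (auto simp: X1_def)
    then have "\<not> \<bar>ev \<zeta> P\<bar> \<le> (X1 * ht P) powr (- w)"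
      using X0[of "X1 * ht P"] P ev_nonzero[OF assms(1) P(1)]
      unfolding approx_solvable_iff by blast
    then have "(X1 * ht P) powr (- w) < \<bar>ev \<zeta> P\<bar>" by simp
    then show ?thesis using h by (simp add: powr_mult)
  qed
  moreover have "0 < X1 powr (- w)" by (simp add: X1_def)
  ultimately show ?thesis unfolding order_at_most_def by blast
qed

lemma w_exp_nonneg: "0 \<le> w_exp n \<zeta>"
proof (cases "n = 0")
  case False
  have "approx_solvable n \<zeta> 0 X" if "X \<ge> 1" for X
    unfolding approx_solvable_iff
    using that by (intro exI[of _ 1]) (simp add: naive_height_def)
  then have "\<forall>\<^sub>F X in at_top. approx_solvable n \<zeta> 0 X"
    by (auto simp: eventually_at_top_linorder)
  then have "\<exists>\<^sub>F X in at_top. approx_solvable n \<zeta> 0 X"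
    by (intro eventually_frequently) auto
  then have "ereal 0 \<le> w_exp n \<zeta>"
    using False by (auto simp: w_exp_def intro!: Sup_upper)
  then show ?thesis by (simp add: zero_ereal_def)
qed (simp add: w_exp_def)

lemma approx_solvable_mono: "approx_solvable m \<zeta> w X \<Longrightarrow> m \<le> n \<Longrightarrow> approx_solvable n \<zeta> w X"
  unfolding approx_solvable_def by (meson order_trans)

lemma w_exp_mono:
  assumes "m \<le> n"
  shows "w_exp m \<zeta> \<le> w_exp n \<zeta>"
proof (cases "m = 0")
  case True
  then show ?thesis using w_exp_nonneg by (simp add: w_exp_def)
next
  case False
  have "(\<exists>\<^sub>F X in at_top. approx_solvable m \<zeta> w X) \<Longrightarrow> (\<exists>\<^sub>F X in at_top. approx_solvable n \<zeta> w X)" for w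
    using assms by (auto elim!: frequently_elim1 intro: approx_solvable_mono)
  then show ?thesis using False assms
    by (auto simp: w_exp_def intro!: Sup_subset_mono)
qed

lemma w_hat_le_w_exp:
  assumes "n \<ge> 1"
  shows "w_hat n \<zeta> \<le> w_exp n \<zeta>"
  using assms unfolding w_exp_def w_hat_def
  by (auto intro!: Sup_subset_mono eventually_frequently)

text \<open>
  Dirichlet's theorem, by counting.  The \<open>(M+1)\<^bsup>n+1\<^esup>\<close> polynomials with coefficients in
  \<open>{0..M}\<close> take values in an interval of length \<open>O(M)\<close>, and by hypothesis these values are
  separated by a multiple of \<open>M\<^bsup>-w\<^esup>\<close>.  So there are at most \<open>O(M\<^bsup>w+1\<^esup>)\<close> of them.
\<close>

lemma order_at_most_ge_degree:
  assumes "0 \<le> w" "order_at_most \<zeta> n w"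
  shows "real n \<le> w"
proof (rule ccontr)
  assume "\<not> real n \<le> w"
  then have wn: "w < real n" by simp
  obtain c where c: "c > 0" "\<And>P. P \<noteq> 0 \<Longrightarrow> degree P \<le> n \<Longrightarrow> c * ht P powr (- w) \<le> \<bar>ev \<zeta> P\<bar>"
    using assms(2) by (rule order_at_mostE) blast
  define S where "S = (\<Sum>j<n + 1. \<bar>\<zeta>\<bar> ^ j)"
  have S0: "0 \<le> S" unfolding S_def by (intro sum_nonneg) auto
  have count: "real M ^ (n + 1) \<le> (2 * S / c + 3) * real M powr (w + 1)" if "M \<ge> 1" for M :: nat
  proof -
    define L where "L = {xs. set xs \<subseteq> {0..int M} \<and> length xs = n + 1}"
    define \<delta> where "\<delta> = c * real M powr (- w)"
    define g where "g xs = \<lfloor>ev \<zeta> (Poly xs) / \<delta>\<rfloor>" for xs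
    define k where "k = \<lceil>real M * S / \<delta>\<rceil>"
    have "\<delta> > 0" using c(1) that by (simp add: \<delta>_def)
    have cardL: "card L = (M + 1) ^ (n + 1)"
    proof -
      have "card {0..int M} = M + 1" by (simp add: nat_add_distrib)
      then show ?thesis unfolding L_def by (simp only: card_lists_length_eq finite_atLeastAtMost_int)
    qed
    have co: "0 \<le> coeff (Poly xs) i \<and> coeff (Poly xs) i \<le> int M" if "xs \<in> L" for xs i
    proof (cases "i < length xs")
      case True
      then have "xs ! i \<in> {0..int M}" using that nth_mem[OF True] unfolding L_def by blast
      then show ?thesis using True by (simp add: nth_default_nth)
    qed (simp add: coeff_Poly_eq nth_default_def)
    have dg: "degree (Poly xs) < n + 1" if "xs \<in> L" for xs
    proof -
      have "coeff (Poly xs) i = 0" if "i > n" for i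
        using that \<open>xs \<in> L\<close> by (simp add: L_def coeff_Poly_eq nth_default_def)
      then have "degree (Poly xs) \<le> n" by (intro degree_le) auto
      then show ?thesis by simp
    qed
    have "inj_on g L"
    proof (rule inj_onI, rule ccontr)
      fix xs ys assume *: "xs \<in> L" "ys \<in> L" "g xs = g ys" "xs \<noteq> ys"
      define D where "D = Poly xs - Poly ys"
      have "D \<noteq> 0"
      proof
        assume "D = 0"
        then have "coeff (Poly xs) i = coeff (Poly ys) i" for i by (simp add: D_def)
        then have "xs ! i = ys ! i" if "i < n + 1" for i
          using that *(1,2) by (metis (mono_tags, lifting) L_def coeff_Poly_eq mem_Collect_eq nth_default_nth)
        then have "xs = ys" using *(1,2) by (intro nth_equalityI) (auto simp: L_def)
        with *(4) show False by contradiction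
      qed
      have "degree D \<le> n"
        using dg[OF *(1)] dg[OF *(2)] unfolding D_def by (intro degree_diff_le) auto
      have "ht D \<le> real M"
      proof -
        obtain i where "ht D = \<bar>real_of_int (coeff D i)\<bar>" using ht_attained by blast
        moreover have "\<bar>coeff D i\<bar> \<le> int M"
          using co[OF *(1), of i] co[OF *(2), of i] unfolding D_def coeff_diff by linarith
        ultimately show ?thesis by linarith
      qed
      then have "\<delta> \<le> c * ht D powr (- w)"
        unfolding \<delta>_def using c(1) assms(1) ht_ge_1[OF \<open>D \<noteq> 0\<close>]
        by (intro mult_left_mono powr_mono2') auto
      also have "\<dots> \<le> \<bar>ev \<zeta> D\<bar>" using c(2) \<open>D \<noteq> 0\<close> \<open>degree D \<le> n\<close> by blast
      also have "ev \<zeta> D = ev \<zeta> (Poly xs) - ev \<zeta> (Poly ys)"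
        by (simp add: D_def of_int_poly_hom.hom_minus)
      finally have "1 \<le> \<bar>ev \<zeta> (Poly xs) / \<delta> - ev \<zeta> (Poly ys) / \<delta>\<bar>"
        using \<open>\<delta> > 0\<close> by (simp add: field_simps flip: diff_divide_distrib)
      then show False using *(3) unfolding g_def by linarith
    qed
    moreover have "g ` L \<subseteq> {- k..k}"
    proof clarify
      fix xs assume xs: "xs \<in> L"
      have "\<bar>ev \<zeta> (Poly xs)\<bar> \<le> (\<Sum>j<n+1. \<bar>of_int (coeff (Poly xs) j) * \<zeta> ^ j\<bar>)"
        unfolding ev_eq_sum[OF dg[OF xs]] by (rule sum_abs)
      also have "\<dots> \<le> (\<Sum>j<n+1. real M * \<bar>\<zeta>\<bar> ^ j)"
      proof (intro sum_mono)
        fix j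
        have "\<bar>real_of_int (coeff (Poly xs) j)\<bar> \<le> real M"
          using co[OF xs, of j] by linarith
        then show "\<bar>of_int (coeff (Poly xs) j) * \<zeta> ^ j\<bar> \<le> real M * \<bar>\<zeta>\<bar> ^ j"
          by (auto simp: abs_mult power_abs intro!: mult_right_mono)
      qed
      also have "\<dots> = real M * S" unfolding S_def by (rule sum_distrib_left [symmetric])
      finally have "\<bar>ev \<zeta> (Poly xs) / \<delta>\<bar> \<le> real M * S / \<delta>"
        using \<open>\<delta> > 0\<close> by (simp add: divide_right_mono)
      then show "g xs \<in> {- k..k}" unfolding g_def k_def by (simp; linarith)
    qed
    ultimately have "card L \<le> card {- k..k}" by (intro card_inj_on_le) auto
    moreover have "0 \<le> k" using S0 \<open>\<delta> > 0\<close> by (simp add: k_def ceiling_mono[of 0, simplified])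
    ultimately have "int ((M + 1) ^ (n + 1)) \<le> 2 * k + 1"
      unfolding cardL card_atLeastAtMost_int by linarith
    then have "real ((M + 1) ^ (n + 1)) \<le> 2 * real_of_int k + 1" by linarith
    also have "\<dots> \<le> 2 * (real M * S / \<delta>) + 3" unfolding k_def by linarith
    also have "real M * S / \<delta> = S / c * real M powr (w + 1)"
      using that c(1) by (simp add: \<delta>_def powr_minus powr_add field_simps)
    also have "2 * \<dots> + 3 \<le> (2 * S / c + 3) * real M powr (w + 1)"
      using that assms(1) ge_one_powr_ge_zero[of "real M" "w + 1"] by (simp add: algebra_simps)
    finally have "real ((M + 1) ^ (n + 1)) \<le> (2 * S / c + 3) * real M powr (w + 1)" .
    moreover have "real M ^ (n + 1) \<le> real ((M + 1) ^ (n + 1))"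
      unfolding semiring_1_class.of_nat_power by (intro power_mono) auto
    ultimately show ?thesis by linarith
  qed
  have "\<forall>\<^sub>F X in at_top. (2 * S / c + 3) * X powr (w + 1) < X powr real (n + 1)"
    using wn by (intro powr_eventually_less) auto
  then have "\<forall>\<^sub>F M in sequentially. (2 * S / c + 3) * real M powr (w + 1) < real M powr real (n + 1)"
    by (rule eventually_compose_filterlim[OF _ filterlim_real_sequentially])
  then obtain M where "M \<ge> 1" "(2 * S / c + 3) * real M powr (w + 1) < real M powr real (n + 1)"
    using eventually_happens'[OF sequentially_bot eventually_conj[OF _ eventually_ge_at_top[of 1]]] by blast
  moreover from this have "real M powr real (n + 1) = real M ^ (n + 1)"
    by (intro powr_realpow) auto
  ultimately show False using count[of M] by linarith
qed

lemma degree_le_w_exp: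
  assumes "\<not> algebraic \<zeta>"
  shows "ereal (real n) \<le> w_exp n \<zeta>"
proof (rule ccontr)
  assume "\<not> ereal (real n) \<le> w_exp n \<zeta>"
  then obtain w where w: "w_exp n \<zeta> < ereal w" "ereal w < ereal (real n)"
    using ereal_dense2 by (meson not_le)
  then have "0 \<le> ereal w" using w_exp_nonneg[of n \<zeta>] by order
  then have "0 \<le> w" by simp
  with w order_at_most_ge_degree[OF _ order_at_most_if_w_exp_less[OF assms]] show False by fastforce
qed

section \<open>Irreducible approximants\<close>

lemma finite_bounded_height: "finite {P :: int poly. degree P \<le> n \<and> ht P \<le> M}"
proof (rule finite_subset)
  let ?L = "{xs. set xs \<subseteq> {- \<lfloor>M\<rfloor>..\<lfloor>M\<rfloor>} \<and> length xs \<le> n + 1}"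
  show "{P :: int poly. degree P \<le> n \<and> ht P \<le> M} \<subseteq> Poly ` ?L"
  proof clarify
    fix P :: "int poly" assume P: "degree P \<le> n" "ht P \<le> M"
    have "coeffs P \<in> ?L"
    proof (intro CollectI conjI subsetI)
      fix a assume "a \<in> set (coeffs P)"
      then obtain i where "a = coeff P i" by (auto simp: coeffs_def split: if_splits)
      then have "\<bar>real_of_int a\<bar> \<le> M" using abs_coeff_le_ht[of P i] P(2) by simp
      then show "a \<in> {- \<lfloor>M\<rfloor>..\<lfloor>M\<rfloor>}" by (simp; linarith)
    qed (use P(1) in \<open>simp add: coeffs_def\<close>)
    then have "Poly (coeffs P) \<in> Poly ` ?L" by (rule imageI)
    then show "P \<in> Poly ` ?L" by simp
  qed
  show "finite (Poly ` ?L)" by (intro finite_imageI finite_lists_length_le) auto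
qed

lemma factor_degree_pos_if_primitive:
  fixes A B :: "int poly"
  assumes "content (A * B) = 1" "\<not> A dvd 1"
  shows "1 \<le> degree A"
proof (rule ccontr)
  assume "\<not> 1 \<le> degree A"
  then obtain a where a: "A = [:a:]" using degree_eq_zeroE[of A] by auto
  have "content A * content B = 1" using assms(1) by (simp add: content_mult)
  then have "is_unit (content A)" by (metis dvd_triv_left)
  then have "is_unit a" unfolding a by simp
  then have "A dvd 1" unfolding a by (simp add: is_unit_const_poly_iff)
  with assms(2) show False by contradiction
qed

text \<open>
  A reducible primitive polynomial of degree \<open>d + 1\<close> is a product of two polynomials of degree at
  most \<open>d\<close>; their lower bounds multiply, and Gelfond's inequality controls the product of the
  heights.  Passing to the primitive part increases neither the value nor the height.
\<close>

lemma order_at_most_Suc: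
  fixes w :: real
  assumes "0 \<le> w" "order_at_most \<zeta> d w" "c > 0"
    and irr: "\<And>P. irreducible P \<Longrightarrow> degree P = Suc d \<Longrightarrow> c * ht P powr (- w) \<le> \<bar>ev \<zeta> P\<bar>"
  shows "order_at_most \<zeta> (Suc d) w"
proof -
  define K where "K = gelfond_const (Suc d)"
  have K: "1 \<le> K" by (simp add: K_def gelfond_const_ge_1)
  obtain b where b: "b > 0" "\<And>P. P \<noteq> 0 \<Longrightarrow> degree P \<le> d \<Longrightarrow> b * ht P powr (- w) \<le> \<bar>ev \<zeta> P\<bar>"
    using assms(2) by (rule order_at_mostE) blast
  define e where "e = min (min b c) (b * b * K powr (- w))"
  have e: "e > 0" "e \<le> b" "e \<le> c" "e \<le> b * b * K powr (- w)"
    using b(1) assms(3) K by (auto simp: e_def)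
  have prim: "e * ht P powr (- w) \<le> \<bar>ev \<zeta> P\<bar>"
    if P: "content P = 1" "degree P = Suc d" for P
  proof (cases "irreducible P")
    case True
    have "e * ht P powr (- w) \<le> c * ht P powr (- w)" using e by (intro mult_right_mono) auto
    then show ?thesis using irr[OF True P(2)] by linarith
  next
    case False
    have "P \<noteq> 0" "\<not> P dvd 1" using P(2) by (auto simp: poly_dvd_1)
    with False obtain A B where AB: "P = A * B" "\<not> A dvd 1" "\<not> B dvd 1"
      by (auto simp: irreducible_def)
    have nz: "A \<noteq> 0" "B \<noteq> 0" using \<open>P \<noteq> 0\<close> AB(1) by auto
    have "1 \<le> degree A" "1 \<le> degree B"
      using factor_degree_pos_if_primitive[of A B] factor_degree_pos_if_primitive[of B A] P(1) AB
      by (auto simp: mult.commute)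
    moreover have "degree A + degree B = Suc d" using P(2) nz by (simp add: AB(1) degree_mult_eq)
    ultimately have deg: "degree A \<le> d" "degree B \<le> d" by auto
    have h: "1 \<le> ht A" "1 \<le> ht B" "1 \<le> ht P"
      using nz \<open>P \<noteq> 0\<close> ht_ge_1 by blast+
    have gel: "ht A * ht B \<le> K * ht P"
      using gelfond[of A B "Suc d"] P(2) by (simp add: K_def AB(1))
    have "e * ht P powr (- w) \<le> b * b * K powr (- w) * ht P powr (- w)"
      using e by (intro mult_right_mono) auto
    also have "\<dots> = b * b * (K * ht P) powr (- w)"
      using K h by (simp add: powr_mult)
    also have "\<dots> \<le> b * b * (ht A * ht B) powr (- w)"
    proof (rule mult_left_mono)
      have "1 * 1 \<le> ht A * ht B" using h by (intro mult_mono) auto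
      then show "(K * ht P) powr (- w) \<le> (ht A * ht B) powr (- w)"
        using assms(1) gel by (intro powr_mono2') linarith+
    qed (use b in auto)
    also have "\<dots> = (b * ht A powr (- w)) * (b * ht B powr (- w))"
      by (simp add: powr_mult)
    also have "\<dots> \<le> \<bar>ev \<zeta> A\<bar> * \<bar>ev \<zeta> B\<bar>"
      using b nz deg by (intro mult_mono) auto
    finally show ?thesis by (simp add: AB(1) ev_mult abs_mult)
  qed
  have "e * ht P powr (- w) \<le> \<bar>ev \<zeta> P\<bar>" if P: "P \<noteq> 0" "degree P \<le> Suc d" for P
  proof (cases "degree P \<le> d")
    case True
    have "e * ht P powr (- w) \<le> b * ht P powr (- w)" using e by (intro mult_right_mono) auto
    then show ?thesis using b(2)[OF P(1) True] by linarith
  next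
    case False
    define R where "R = primitive_part P"
    have cont: "content P \<noteq> 0" "0 \<le> content P" using P(1) by (auto intro: content_ge_0_int)
    then have c1: "1 \<le> content P" by linarith
    have PR: "P = [:content P:] * R" by (simp add: R_def content_times_primitive_part)
    have R: "content R = 1" "degree R = Suc d" "R \<noteq> 0"
      using P False by (auto simp: R_def)
    have "ht R \<le> ht P"
    proof -
      obtain i where "ht R = \<bar>real_of_int (coeff R i)\<bar>" using ht_attained by blast
      also have "\<dots> \<le> real_of_int (content P) * \<bar>real_of_int (coeff R i)\<bar>"
        using c1 mult_right_mono[of 1 "real_of_int (content P)" "\<bar>real_of_int (coeff R i)\<bar>"] by simp
      also have "\<dots> = \<bar>real_of_int (coeff P i)\<bar>"
        using c1 by (subst PR) (simp add: abs_mult)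
      finally show ?thesis using abs_coeff_le_ht[of P i] by linarith
    qed
    then have "e * ht P powr (- w) \<le> e * ht R powr (- w)"
      using e(1) assms(1) ht_ge_1[OF R(3)] by (intro mult_left_mono powr_mono2') auto
    also have "\<dots> \<le> \<bar>ev \<zeta> R\<bar>" using prim R by blast
    also have "\<dots> \<le> real_of_int (content P) * \<bar>ev \<zeta> R\<bar>"
      using c1 mult_right_mono[of 1 "real_of_int (content P)" "\<bar>ev \<zeta> R\<bar>"] by simp
    also have "\<dots> = \<bar>ev \<zeta> P\<bar>"
    proof -
      have "ev \<zeta> P = ev \<zeta> [:content P:] * ev \<zeta> R" by (subst PR, rule ev_mult)
      then show ?thesis using c1 by (simp add: ev_const abs_mult)
    qed
    finally show ?thesis .
  qed
  with e(1) show ?thesis unfolding order_at_most_def by blast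
qed

lemma order_at_most_if_irreducible:
  fixes w :: real
  assumes "0 \<le> w" "c > 0"
    and irr: "\<And>P. irreducible P \<Longrightarrow> 1 \<le> degree P \<Longrightarrow> degree P \<le> l \<Longrightarrow> c * ht P powr (- w) \<le> \<bar>ev \<zeta> P\<bar>"
  shows "order_at_most \<zeta> l w"
proof -
  have "d \<le> l \<Longrightarrow> order_at_most \<zeta> d w" for d
  proof (induction d)
    case 0
    show ?case using assms(1) by (rule order_at_most_0)
  next
    case (Suc d)
    then show ?case
      by (intro order_at_most_Suc[OF assms(1) _ assms(2)] irr) auto
  qed
  then show ?thesis by simp
qed

text \<open>
  The constant \<open>c\<close> may be lowered below the finitely many nonzero values of polynomials of height
  at most \<open>M\<close>, which forces the height of the approximant beyond \<open>M\<close>.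
\<close>

lemma irreducible_approximant:
  assumes "\<not> algebraic \<zeta>" "0 \<le> w" "\<not> order_at_most \<zeta> l w" "c > 0"
  obtains P where "irreducible P" "1 \<le> degree P" "degree P \<le> l" "M \<le> ht P"
    "\<bar>ev \<zeta> P\<bar> < c * ht P powr (- w)"
proof -
  define F where "F = {P. P \<noteq> 0 \<and> degree P \<le> l \<and> ht P \<le> M}"
  have fin: "finite F"
    by (rule finite_subset[OF _ finite_bounded_height[of l M]]) (auto simp: F_def)
  define m where "m = Min (insert c ((\<lambda>P. \<bar>ev \<zeta> P\<bar>) ` F))"
  have m: "0 < m" "m \<le> c" "\<And>P. P \<in> F \<Longrightarrow> m \<le> \<bar>ev \<zeta> P\<bar>"
    using fin assms(4) ev_nonzero[OF assms(1)] by (auto simp: m_def F_def)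
  have "\<exists>P. irreducible P \<and> 1 \<le> degree P \<and> degree P \<le> l \<and> \<not> m * ht P powr (- w) \<le> \<bar>ev \<zeta> P\<bar>"
    using assms(3) order_at_most_if_irreducible[OF assms(2) m(1), of l \<zeta>] by blast
  then obtain P where P: "irreducible P" "1 \<le> degree P" "degree P \<le> l"
      "\<bar>ev \<zeta> P\<bar> < m * ht P powr (- w)" by (auto simp: not_le)
  have "P \<noteq> 0" using P(1) by auto
  have le1: "ht P powr (- w) \<le> 1 powr (- w)"
    using assms(2) ht_ge_1[OF \<open>P \<noteq> 0\<close>] by (intro powr_mono2') auto
  have "m * ht P powr (- w) \<le> m * 1"
    using m(1) le1 by (intro mult_left_mono) auto
  then have "\<bar>ev \<zeta> P\<bar> < m" using P(4) by linarith
  then have "P \<notin> F" using m(3) by fastforce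
  then have "M \<le> ht P" using \<open>P \<noteq> 0\<close> P(3) by (auto simp: F_def)
  moreover have "m * ht P powr (- w) \<le> c * ht P powr (- w)" using m by (intro mult_right_mono) auto
  ultimately show ?thesis using that P by fastforce
qed

text \<open>
  Asking for a constant below the one of the lower bound in degree \<open>l - 1\<close> excludes all smaller
  degrees.
\<close>

lemma irreducible_approximant_exact_degree:
  assumes "\<not> algebraic \<zeta>" "0 \<le> w" "\<not> order_at_most \<zeta> l w" "order_at_most \<zeta> (l - 1) w"
  obtains P where "irreducible P" "degree P = l" "M \<le> ht P" "\<bar>ev \<zeta> P\<bar> < ht P powr (- w)"
proof -
  obtain c where c: "c > 0" "\<And>P. P \<noteq> 0 \<Longrightarrow> degree P \<le> l - 1 \<Longrightarrow> c * ht P powr (- w) \<le> \<bar>ev \<zeta> P\<bar>"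
    using assms(4) by (rule order_at_mostE) blast
  obtain P where P: "irreducible P" "1 \<le> degree P" "degree P \<le> l" "M \<le> ht P"
    "\<bar>ev \<zeta> P\<bar> < min 1 c * ht P powr (- w)"
    using irreducible_approximant[OF assms(1-3), of "min 1 c" M] c(1) by auto
  have min_le: "min 1 c * ht P powr (- w) \<le> 1 * ht P powr (- w)" "min 1 c * ht P powr (- w) \<le> c * ht P powr (- w)"
    by (intro mult_right_mono; simp)+
  have "\<not> degree P \<le> l - 1"
    using c(2)[of P] P(1,5) min_le(2) by auto
  then have "degree P = l" using P(3) by simp
  then show ?thesis using that P(1,4,5) min_le(1) by fastforce
qed

text \<open>
  For a \<open>w'\<close> above both \<open>w\<close> and \<open>w\<^bsub>l-1\<^esub>\<close> and below \<open>w\<^sub>l\<close>, values are bounded below with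
  exponent \<open>w'\<close> in degree \<open>l - 1\<close> but not in degree \<open>l\<close>.
\<close>

lemma irreducible_approximant_exponent:
  assumes tr: "\<not> algebraic \<zeta>" and l: "1 \<le> l"
    and less: "w_exp (l - 1) \<zeta> < w_exp l \<zeta>" "ereal w < w_exp l \<zeta>"
  shows "\<exists>P y. irreducible P \<and> degree P = l \<and> M \<le> ht P \<and> \<bar>ev \<zeta> P\<bar> = ht P powr (- y) \<and> w < y"
proof -
  obtain w' where w': "max (ereal w) (w_exp (l - 1) \<zeta>) < ereal w'" "ereal w' < w_exp l \<zeta>"
    using ereal_dense2[of "max (ereal w) (w_exp (l - 1) \<zeta>)" "w_exp l \<zeta>"] less by auto
  have "0 \<le> w'"
  proof -
    have "w_exp (l - 1) \<zeta> < ereal w'" using w'(1) by simp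
    with w_exp_nonneg have "0 < ereal w'" by (rule le_less_trans)
    then show ?thesis by simp
  qed
  have "\<not> order_at_most \<zeta> l w'"
    using w_exp_le_if_order_at_most[OF \<open>0 \<le> w'\<close>, of \<zeta> l] w'(2) by auto
  moreover have "order_at_most \<zeta> (l - 1) w'"
    using w'(1) by (intro order_at_most_if_w_exp_less[OF tr \<open>0 \<le> w'\<close>]) auto
  ultimately obtain P where P: "irreducible P" "degree P = l" "max M 2 \<le> ht P" "\<bar>ev \<zeta> P\<bar> < ht P powr (- w')"
    using irreducible_approximant_exact_degree[OF tr \<open>0 \<le> w'\<close>] by metis
  define y where "y = - log (ht P) \<bar>ev \<zeta> P\<bar>"
  have "P \<noteq> 0" using P(1) by auto
  have "2 \<le> ht P" using P(3) by simp
  then have y: "\<bar>ev \<zeta> P\<bar> = ht P powr (- y)"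
    using ev_nonzero[OF tr \<open>P \<noteq> 0\<close>] by (simp add: y_def)
  have "- y < - w'" using P(4) \<open>2 \<le> ht P\<close> unfolding y by simp
  then have "w < y" using w'(1) by auto
  then show ?thesis using P y by auto
qed

section \<open>The two bounds\<close>

text \<open>
  A solution \<open>Q\<close> at \<open>X = H(P) / (2 K)\<close> is too small to be a multiple of \<open>P\<close>.  The approximant \<open>P\<close>
  is chosen with constant \<open>1 / (4 C)\<close> and with height so large that the two terms of the resultant
  estimate contribute at most \<open>1/4\<close> each.
\<close>

lemma uniform_exponent_le_sum:
  fixes n l :: nat
  assumes tr: "\<not> algebraic \<zeta>" and "1 \<le> n" "1 \<le> l"
    and norder: "\<not> order_at_most \<zeta> l (real n + real l - 1)"
    and solv: "\<forall>\<^sub>F X in at_top. approx_solvable n \<zeta> v X"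
  shows "v \<le> real n + real l - 1"
proof (rule ccontr)
  define w where "w = real n + real l - 1"
  assume "\<not> v \<le> real n + real l - 1"
  then have vw: "w < v" by (simp add: w_def)
  have w0: "0 \<le> w" using assms(2,3) by (simp add: w_def)
  define K where "K = gelfond_const n"
  have K: "1 \<le> K" by (simp add: K_def gelfond_const_ge_1)
  obtain C where C: "C > 0" "\<And>P Q. irreducible P \<Longrightarrow> 1 \<le> degree P \<Longrightarrow> degree P \<le> l \<Longrightarrow> Q \<noteq> 0 \<Longrightarrow>
       degree Q \<le> n \<Longrightarrow> \<not> P dvd Q \<Longrightarrow>
       1 \<le> C * (\<bar>ev \<zeta> P\<bar> * ht P ^ (n - 1) * ht Q ^ l + \<bar>ev \<zeta> Q\<bar> * ht P ^ n * ht Q ^ (l - 1))"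
    using resultant_lower_bound[OF \<open>1 \<le> n\<close>, where l = l and \<zeta> = \<zeta>] by blast
  obtain X0 where X0: "\<And>X. X \<ge> X0 \<Longrightarrow> approx_solvable n \<zeta> v X"
    using solv by (auto simp: eventually_at_top_linorder)
  have "\<forall>\<^sub>F H in at_top. (4 * C * (2 * K) powr v) * H powr w < H powr v"
    using vw by (intro powr_eventually_less)
  then obtain M where M: "\<And>H. H \<ge> M \<Longrightarrow> (4 * C * (2 * K) powr v) * H powr w < H powr v"
    by (auto simp: eventually_at_top_linorder)
  obtain P where P: "irreducible P" "1 \<le> degree P" "degree P \<le> l" "max M (2 * K * X0) \<le> ht P"
      "\<bar>ev \<zeta> P\<bar> < 1 / (4 * C) * ht P powr (- w)"
    using irreducible_approximant[OF tr w0, of l "1 / (4 * C)" "max M (2 * K * X0)"] norder C(1)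
    by (auto simp: w_def)
  define H where "H = ht P"
  have "P \<noteq> 0" using P(1) by auto
  then have H: "1 \<le> H" unfolding H_def by (rule ht_ge_1)
  define X where "X = H / (2 * K)"
  have "X0 \<le> X" using P(4) K by (simp add: X_def H_def field_simps)
  then obtain Q where Q: "degree Q \<le> n" "ht Q \<le> X" "ev \<zeta> Q \<noteq> 0" "\<bar>ev \<zeta> Q\<bar> \<le> X powr (- v)"
    using X0 unfolding approx_solvable_iff by blast
  have "Q \<noteq> 0" using Q(3) by auto
  have "\<not> P dvd Q"
  proof
    assume "P dvd Q"
    then obtain R where R: "Q = P * R" by (auto elim: dvdE)
    with \<open>Q \<noteq> 0\<close> have "1 \<le> ht R" by (intro ht_ge_1) auto
    then have "H * 1 \<le> H * ht R" using H by (intro mult_left_mono) auto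
    also have "\<dots> \<le> K * ht Q" using gelfond[of P R n] Q(1) R by (simp add: K_def H_def)
    also have "\<dots> \<le> K * X" using Q(2) K by (intro mult_left_mono) auto
    also have "\<dots> = H / 2" using K by (simp add: X_def)
    finally show False using H by simp
  qed
  have "X * 1 \<le> X * (2 * K)" using K H by (intro mult_left_mono) (auto simp: X_def)
  then have XH: "X \<le> H" using K by (simp add: X_def)
  then have QH: "ht Q \<le> H" using Q(2) by simp
  have Hw: "H ^ (n - 1) * H ^ l = H powr w" "H ^ n * H ^ (l - 1) = H powr w"
  proof -
    have "w = real (n - 1 + l)" "w = real (n + (l - 1))"
      using assms(2,3) by (simp_all add: w_def of_nat_diff)
    then show "H ^ (n - 1) * H ^ l = H powr w" "H ^ n * H ^ (l - 1) = H powr w"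
      using H powr_realpow[of H "n - 1 + l"] powr_realpow[of H "n + (l - 1)"]
      by (simp_all add: power_add)
  qed
  have "1 \<le> C * (\<bar>ev \<zeta> P\<bar> * H ^ (n - 1) * ht Q ^ l + \<bar>ev \<zeta> Q\<bar> * H ^ n * ht Q ^ (l - 1))"
    using C(2)[OF P(1-3) \<open>Q \<noteq> 0\<close> Q(1) \<open>\<not> P dvd Q\<close>] by (simp add: H_def)
  also have "\<dots> \<le> C * (1 / (4 * C) * H powr (- w) * H ^ (n - 1) * H ^ l + X powr (- v) * H ^ n * H ^ (l - 1))"
    using P(5) Q(4) QH H C(1) unfolding H_def
    by (intro mult_left_mono add_mono mult_mono power_mono) auto
  also have "\<dots> = 1 / 4 * (H powr (- w) * (H ^ (n - 1) * H ^ l))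
      + C * X powr (- v) * (H ^ n * H ^ (l - 1))"
    using C(1) by (simp add: distrib_left mult_ac)
  also have "\<dots> = 1 / 4 + C * X powr (- v) * H powr w"
    unfolding Hw using H by (simp flip: powr_add)
  also have "X powr (- v) = (2 * K) powr v * H powr (- v)"
    using H K by (simp add: X_def powr_divide powr_minus field_simps)
  also have "C * \<dots> * H powr w < 1 / 4"
    using M[of H] P(4) H by (simp add: H_def powr_minus field_simps)
  finally show False by simp
qed

text \<open>
  The information contained in a single approximant \<open>P\<close> of large height, multiplied through by
  \<open>\<theta>\<close>.  The first argument of the maximum comes from solutions not divisible by \<open>P\<close>, the second from
  multiples of \<open>P\<close>.  The loss \<open>\<tau>\<close> in \<open>\<theta>\<close> makes the term with \<open>\<bar>P(\<zeta>)\<bar>\<close> in the resultant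
  estimate at most \<open>H(P)\<^bsup>-\<tau>\<^esup>\<close>, and the loss \<open>\<tau>\<close> in the conclusion absorbs the constants.
\<close>

lemma uniform_exponent_bound_from_approximant:
  fixes n l :: nat
  assumes ln: "1 \<le> l" "l \<le> n"
    and solv: "\<forall>\<^sub>F X in at_top. approx_solvable n \<zeta> v X"
    and cof: "order_at_most \<zeta> (n - l) s" "0 \<le> s"
    and "0 < \<tau>"
  shows "\<exists>M. \<forall>P y. irreducible P \<longrightarrow> degree P = l \<longrightarrow> M \<le> ht P \<longrightarrow> \<bar>ev \<zeta> P\<bar> = ht P powr (- y) \<longrightarrow>
    real n + real l - 1 \<le> y \<longrightarrow> 1 \<le> (y - real l + 1) / n - \<tau> \<longrightarrow>
    (let \<theta> = (y - real l + 1) / n - \<tau>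
     in v * \<theta> \<le> max ((real l - 1) * \<theta> + n) (y + (\<theta> - 1) * s) + \<tau>)"
proof -
  have n1: "1 \<le> n" using ln by simp
  define K where "K = gelfond_const n"
  have K: "1 \<le> K" by (simp add: K_def gelfond_const_ge_1)
  obtain C where C: "C > 0" "\<And>P Q. irreducible P \<Longrightarrow> 1 \<le> degree P \<Longrightarrow> degree P \<le> l \<Longrightarrow> Q \<noteq> 0 \<Longrightarrow>
       degree Q \<le> n \<Longrightarrow> \<not> P dvd Q \<Longrightarrow>
       1 \<le> C * (\<bar>ev \<zeta> P\<bar> * ht P ^ (n - 1) * ht Q ^ l + \<bar>ev \<zeta> Q\<bar> * ht P ^ n * ht Q ^ (l - 1))"
    using resultant_lower_bound[OF n1, where l = l and \<zeta> = \<zeta>] by blast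
  obtain c where c: "c > 0" "\<And>P. P \<noteq> 0 \<Longrightarrow> degree P \<le> n - l \<Longrightarrow> c * ht P powr (- s) \<le> \<bar>ev \<zeta> P\<bar>"
    using cof(1) by (rule order_at_mostE) blast
  obtain X0 where X0: "\<And>X. X \<ge> X0 \<Longrightarrow> approx_solvable n \<zeta> v X"
    using solv by (auto simp: eventually_at_top_linorder)
  define B where "B = max (2 * C) (K powr s / c)"
  have "\<forall>\<^sub>F H in at_top. B * H powr 0 < H powr \<tau>"
    using \<open>0 < \<tau>\<close> by (intro powr_eventually_less)
  then obtain M where M: "\<And>H. H \<ge> M \<Longrightarrow> B * H powr 0 < H powr \<tau>"
    by (auto simp: eventually_at_top_linorder)
  show ?thesis
  proof (intro exI[of _ "max M (max 2 X0)"] allI impI)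
    fix P :: "int poly" and y :: real
    assume P: "irreducible P" "degree P = l" "max M (max 2 X0) \<le> ht P" "\<bar>ev \<zeta> P\<bar> = ht P powr (- y)"
      and y: "real n + real l - 1 \<le> y" "1 \<le> (y - real l + 1) / n - \<tau>"
    define \<theta> where "\<theta> = (y - real l + 1) / n - \<tau>"
    define H where "H = ht P"
    define X where "X = H powr \<theta>"
    have H: "2 \<le> H" "X0 \<le> H" using P(3) by (auto simp: H_def)
    have big: "2 * C < H powr \<tau>" "K powr s / c < H powr \<tau>"
      using M[of H] P(3) H(1) by (auto simp: H_def B_def)
    have \<theta>1: "1 \<le> \<theta>" using y(2) by (simp add: \<theta>_def)
    have "H powr 1 \<le> X" unfolding X_def using \<theta>1 H by (intro powr_mono) auto
    then have "X0 \<le> X" and "0 < X" using H by auto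
    then obtain Q where Q: "degree Q \<le> n" "ht Q \<le> X" "ev \<zeta> Q \<noteq> 0" "\<bar>ev \<zeta> Q\<bar> \<le> X powr (- v)"
      using X0 unfolding approx_solvable_iff by blast
    have "Q \<noteq> 0" using Q(3) by auto
    have Xv: "X powr (- v) = H powr (- (v * \<theta>))"
      by (simp add: X_def powr_powr mult.commute)
    have Xk: "X ^ k = H powr (real k * \<theta>)" for k
      using \<open>0 < X\<close> by (simp add: X_def powr_powr mult.commute flip: powr_realpow)
    have Hk: "H ^ k = H powr real k" for k
      using H by (simp add: powr_realpow)
    have "v * \<theta> \<le> max ((real l - 1) * \<theta> + n) (y + (\<theta> - 1) * s) + \<tau>"
    proof (cases "P dvd Q")
      case False
      show ?thesis
      proof (rule ccontr)
        assume "\<not> ?thesis"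
        then have *: "(real l - 1) * \<theta> + n + \<tau> < v * \<theta>" by simp
        have e1: "- y + real (n - 1) + real l * \<theta> \<le> - \<tau>"
        proof -
          \<comment> \<open>it says that \<open>(y-l+1)/n \<le> (y-n+1)/l\<close>, where the right-hand side is the largest
             admissible exponent for the term with \<open>\<bar>P(\<zeta>)\<bar>\<close>\<close>
          have "0 \<le> (real n - real l) * (y + 1 - n - l)"
            using ln y(1) by (intro mult_nonneg_nonneg) auto
          then have "real l * (y - real l + 1) \<le> (y - real n + 1) * n"
            by (simp add: algebra_simps)
          then have "real l * ((y - real l + 1) / n) \<le> y - real n + 1"
            using n1 by (simp add: field_simps)
          moreover have "1 * \<tau> \<le> real l * \<tau>"
            using ln \<open>0 < \<tau>\<close> by (intro mult_right_mono) auto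
          ultimately show ?thesis
            using n1 by (simp add: \<theta>_def right_diff_distrib of_nat_diff)
        qed
        have e2: "- (v * \<theta>) + real n + real (l - 1) * \<theta> \<le> - \<tau>"
          using * ln by (simp add: of_nat_diff)
        have "1 \<le> C * (\<bar>ev \<zeta> P\<bar> * H ^ (n - 1) * ht Q ^ l + \<bar>ev \<zeta> Q\<bar> * H ^ n * ht Q ^ (l - 1))"
          using C(2)[OF P(1) _ _ \<open>Q \<noteq> 0\<close> Q(1) False] P(2) ln by (simp add: H_def)
        also have "\<dots> \<le> C * (H powr (- y) * H ^ (n - 1) * X ^ l + X powr (- v) * H ^ n * X ^ (l - 1))"
          using P(4) Q(2,4) H C(1) \<open>0 < X\<close> unfolding H_def
          by (intro mult_left_mono add_mono mult_mono power_mono) auto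
        also have "\<dots> = C * (H powr (- y + real (n - 1) + real l * \<theta>)
            + H powr (- (v * \<theta>) + real n + real (l - 1) * \<theta>))"
          unfolding Xv Xk Hk powr_add ..
        also have "\<dots> \<le> C * (H powr (- \<tau>) + H powr (- \<tau>))"
          using e1 e2 H C(1) by (intro mult_left_mono add_mono powr_mono) auto
        also have "\<dots> < 1"
          using big(1) H by (simp add: powr_minus field_simps)
        finally show False by simp
      qed
    next
      case True
      then obtain R where R: "Q = P * R" by (auto elim: dvdE)
      with \<open>Q \<noteq> 0\<close> have "R \<noteq> 0" "P \<noteq> 0" by auto
      then have "degree R \<le> n - l" using Q(1) P(2) by (simp add: R degree_mult_eq)
      have "1 \<le> ht R" using \<open>R \<noteq> 0\<close> by (rule ht_ge_1)
      have "H * ht R \<le> K * ht Q" using gelfond[of P R n] Q(1) by (simp add: K_def H_def R)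
      also have "\<dots> \<le> K * X" using Q(2) K by (intro mult_left_mono) auto
      also have "\<dots> = H * (K * H powr (\<theta> - 1))"
        using H by (simp add: X_def powr_diff)
      finally have hR: "ht R \<le> K * H powr (\<theta> - 1)" using H by simp
      have "c * K powr (- s) * H powr (- ((\<theta> - 1) * s)) = c * (K * H powr (\<theta> - 1)) powr (- s)"
        using K by (simp add: powr_mult powr_powr)
      also have "\<dots> \<le> c * ht R powr (- s)"
        using c(1) cof(2) hR \<open>1 \<le> ht R\<close> by (intro mult_left_mono powr_mono2') auto
      also have "\<dots> \<le> \<bar>ev \<zeta> R\<bar>" using c(2) \<open>R \<noteq> 0\<close> \<open>degree R \<le> n - l\<close> by blast
      finally have "c * K powr (- s) * H powr (- ((\<theta> - 1) * s)) * H powr (- y) \<le> \<bar>ev \<zeta> R\<bar> * H powr (- y)"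
        by (intro mult_right_mono) auto
      also have "\<dots> = \<bar>ev \<zeta> Q\<bar>" using P(4) by (simp add: R ev_mult abs_mult H_def)
      also have "\<dots> \<le> H powr (- (v * \<theta>))" using Q(4) by (simp add: Xv)
      finally have main: "c * K powr (- s) * H powr (- ((\<theta> - 1) * s) - y) \<le> H powr (- (v * \<theta>))"
        using powr_add[of H "- ((\<theta> - 1) * s)" "- y"] by (simp add: mult.assoc)
      show ?thesis
      proof (rule ccontr)
        assume "\<not> ?thesis"
        then have *: "y + (\<theta> - 1) * s + \<tau> < v * \<theta>" by simp
        have "H powr (- (v * \<theta>)) \<le> H powr (- ((\<theta> - 1) * s) - y - \<tau>)"
          using * H by (intro powr_mono) auto
        also have "\<dots> = H powr (- ((\<theta> - 1) * s) - y) / H powr \<tau>"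
          using H by (simp add: powr_diff)
        finally have "c * K powr (- s) * H powr (- ((\<theta> - 1) * s) - y)
            \<le> H powr (- ((\<theta> - 1) * s) - y) / H powr \<tau>" using main by linarith
        then have "c * K powr (- s) \<le> 1 / H powr \<tau>"
          using H by (simp add: field_simps)
        then have "H powr \<tau> \<le> K powr s / c"
          using H c(1) K by (simp add: powr_minus field_simps)
        with big(2) show False by simp
      qed
    qed
    then show "let \<theta> = (y - real l + 1) / n - \<tau>
       in v * \<theta> \<le> max ((real l - 1) * \<theta> + n) (y + (\<theta> - 1) * s) + \<tau>"
      by (simp add: \<theta>_def Let_def)
  qed
qed

text \<open>
  The parameter \<open>r\<close> is the limit of \<open>1/\<theta> = n/(y-l+1)\<close>.  It treats finite and infinite \<open>w\<^sub>n\<close>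
  together: \<open>r = n/(w\<^sub>n-l+1)\<close> in the first case and \<open>r = 0\<close> in the second.  Rewriting
  \<open>y = n \<theta> + l - 1\<close> removes \<open>y\<close>, which may be unbounded.
\<close>

lemma uniform_exponent_bound_limit:
  fixes n l :: nat and r s v \<zeta> :: real
  assumes tr: "\<not> algebraic \<zeta>" and ln: "1 \<le> l" "l \<le> n"
    and solv: "\<forall>\<^sub>F X in at_top. approx_solvable n \<zeta> v X"
    and s: "w_exp (n - l) \<zeta> = ereal s"
    and r: "0 \<le> r" "r < 1"
    and approx: "\<And>\<epsilon> M. \<epsilon> > 0 \<Longrightarrow> \<exists>P y. irreducible P \<and> degree P = l \<and> M \<le> ht P \<and>
        \<bar>ev \<zeta> P\<bar> = ht P powr (- y) \<and> real n + real l - 1 \<le> y \<and> \<bar>n / (y - real l + 1) - r\<bar> < \<epsilon>"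
  shows "v \<le> n + (real l - 1) * r + (1 - r) * s"
proof -
  have n1: "1 \<le> n" using ln by simp
  define \<tau> where "\<tau> k = 1 / real (Suc k)" for k
  have \<tau>: "0 < \<tau> k" for k by (simp add: \<tau>_def)
  have s0: "0 \<le> s" using w_exp_nonneg[of "n - l" \<zeta>] by (simp add: s zero_ereal_def)
  have "\<exists>y. real n + real l - 1 \<le> y \<and> \<bar>n / (y - real l + 1) - r\<bar> < \<tau> k \<and>
      (1 \<le> (y - real l + 1) / n - \<tau> k \<longrightarrow>
       (let \<theta> = (y - real l + 1) / n - \<tau> k
        in v * \<theta> \<le> max ((real l - 1) * \<theta> + n) (y + (\<theta> - 1) * (s + \<tau> k)) + \<tau> k))" for k
  proof -
    have "order_at_most \<zeta> (n - l) (s + \<tau> k)"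
      by (rule order_at_most_if_w_exp_less[OF tr]) (use s s0 \<tau>[of k] in auto)
    from uniform_exponent_bound_from_approximant[OF ln solv this _ \<tau>] s0 \<tau>[of k]
    obtain M where M: "\<forall>P y. irreducible P \<longrightarrow> degree P = l \<longrightarrow> M \<le> ht P \<longrightarrow> \<bar>ev \<zeta> P\<bar> = ht P powr (- y) \<longrightarrow>
      real n + real l - 1 \<le> y \<longrightarrow> 1 \<le> (y - real l + 1) / n - \<tau> k \<longrightarrow>
      (let \<theta> = (y - real l + 1) / n - \<tau> k
       in v * \<theta> \<le> max ((real l - 1) * \<theta> + n) (y + (\<theta> - 1) * (s + \<tau> k)) + \<tau> k)" by auto
    then show ?thesis using approx[OF \<tau>[of k], of M] by blast
  qed
  then obtain y where y: "\<And>k. real n + real l - 1 \<le> y k"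
    "\<And>k. \<bar>n / (y k - real l + 1) - r\<bar> < \<tau> k"
    "\<And>k. 1 \<le> (y k - real l + 1) / n - \<tau> k \<Longrightarrow>
       (let \<theta> = (y k - real l + 1) / n - \<tau> k
        in v * \<theta> \<le> max ((real l - 1) * \<theta> + n) (y k + (\<theta> - 1) * (s + \<tau> k)) + \<tau> k)"
    by metis
  define q where "q k = n / (y k - real l + 1)" for k
  define \<rho> where "\<rho> k = q k / (1 - \<tau> k * q k)" for k
  have \<tau>0: "\<tau> \<longlonglongrightarrow> 0" unfolding \<tau>_def by (rule LIMSEQ_Suc[OF lim_1_over_n])
  have "(\<lambda>k. q k - r) \<longlonglongrightarrow> 0"
    using y(2) by (intro Lim_null_comparison[OF _ \<tau>0]) (auto simp: q_def less_imp_le)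
  then have qr: "q \<longlonglongrightarrow> r" by (simp add: LIM_zero_iff)
  have "\<rho> \<longlonglongrightarrow> r / (1 - 0 * r)"
    unfolding \<rho>_def by (intro tendsto_intros qr \<tau>0) auto
  then have \<rho>r: "\<rho> \<longlonglongrightarrow> r" by simp
  have "(\<lambda>k. \<tau> k * q k) \<longlonglongrightarrow> 0 * r" by (intro tendsto_intros qr \<tau>0)
  then have "\<forall>\<^sub>F k in sequentially. \<tau> k * q k < 1"
    by (intro order_tendstoD) auto
  moreover have "\<forall>\<^sub>F k in sequentially. \<rho> k < 1" using \<rho>r r by (intro order_tendstoD)
  ultimately have bound: "\<forall>\<^sub>F k in sequentially.
     v \<le> max (real l - 1 + n * \<rho> k)
          (n + (n * \<tau> k + real l - 1) * \<rho> k + (1 - \<rho> k) * (s + \<tau> k)) + \<tau> k * \<rho> k"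
  proof eventually_elim
    case (elim k)
    define \<theta> where "\<theta> = (y k - real l + 1) / n - \<tau> k"
    have pos: "0 < y k - real l + 1" using y(1)[of k] n1 by linarith
    then have q0: "0 < q k" using n1 by (simp add: q_def)
    have \<theta>: "\<theta> = 1 / q k - \<tau> k" by (simp add: \<theta>_def q_def)
    have \<rho>\<theta>: "\<rho> k = 1 / \<theta>"
      using q0 by (simp add: \<rho>_def \<theta> field_simps)
    have "0 < \<rho> k" using q0 elim(1) by (simp add: \<rho>_def)
    then have \<theta>0: "0 < \<theta>" by (simp add: \<rho>\<theta> zero_less_divide_iff)
    have "1 \<le> \<theta>" using elim(2) \<theta>0 by (simp add: \<rho>\<theta>)
    have yk: "y k = n * \<theta> + n * \<tau> k + real l - 1"
      using n1 by (simp add: \<theta>_def field_simps)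
    have "v * \<theta> \<le> max ((real l - 1) * \<theta> + n) (y k + (\<theta> - 1) * (s + \<tau> k)) + \<tau> k"
      using y(3)[of k] \<open>1 \<le> \<theta>\<close> by (simp add: \<theta>_def Let_def)
    also have "\<dots> = (max (real l - 1 + n * \<rho> k)
        (n + (n * \<tau> k + real l - 1) * \<rho> k + (1 - \<rho> k) * (s + \<tau> k)) + \<tau> k * \<rho> k) * \<theta>"
      using \<theta>0 unfolding distrib_right max_mult_distrib_right
      by (simp add: \<rho>\<theta> yk field_simps)
    finally show ?case using \<theta>0 by simp
  qed
  have "(\<lambda>k. max (real l - 1 + n * \<rho> k)
          (n + (n * \<tau> k + real l - 1) * \<rho> k + (1 - \<rho> k) * (s + \<tau> k)) + \<tau> k * \<rho> k)
     \<longlonglongrightarrow> max (real l - 1 + n * r) (n + (real n * 0 + real l - 1) * r + (1 - r) * (s + 0)) + 0 * r"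
    by (intro tendsto_intros \<rho>r \<tau>0)
  from tendsto_lowerbound[OF this bound]
  have "v \<le> max (real l - 1 + n * r) (n + (real l - 1) * r + (1 - r) * s)" by simp
  \<comment> \<open>the multiples of \<open>P\<close> give the weaker bound\<close>
  moreover have "real l - 1 + n * r \<le> n + (real l - 1) * r + (1 - r) * s"
  proof -
    have "0 \<le> (n - (real l - 1)) * (1 - r)" "0 \<le> (1 - r) * s"
      using ln r s0 by (auto intro!: mult_nonneg_nonneg)
    then show ?thesis by (simp add: algebra_simps)
  qed
  ultimately show ?thesis by simp
qed

theorem theorem2p2:
  fixes n l :: nat and \<zeta> :: real
  assumes "n \<ge> 1"
    and "\<not> algebraic \<zeta>"
    and "l = (LEAST k. k \<in> {1..n} \<and> w_exp k \<zeta> = w_exp n \<zeta>)"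
  shows "w_hat n \<zeta> \<le> min (ereal (real n + real l - 1)) (second_bound n l \<zeta>)"
proof -
  note tr = assms(2)
  have "l \<in> {1..n} \<and> w_exp l \<zeta> = w_exp n \<zeta>"
    unfolding assms(3) by (rule LeastI[of _ n]) (use assms(1) in auto)
  then have ln: "1 \<le> l" "l \<le> n" and wl: "w_exp l \<zeta> = w_exp n \<zeta>" by auto
  have wn: "ereal (real n) \<le> w_exp n \<zeta>" by (rule degree_le_w_exp[OF tr])
  have less: "w_exp (l - 1) \<zeta> < w_exp l \<zeta>"
  proof (cases "l = 1")
    case True
    have "0 < ereal (real n)" using assms(1) by simp
    then have "0 < w_exp n \<zeta>" using wn by (rule less_le_trans)
    then show ?thesis using True wl by (simp add: w_exp_def[of 0])
  next
    case False
    have "\<not> (l - 1 \<in> {1..n} \<and> w_exp (l - 1) \<zeta> = w_exp n \<zeta>)"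
      using not_less_Least[of "l - 1" "\<lambda>k. k \<in> {1..n} \<and> w_exp k \<zeta> = w_exp n \<zeta>"] ln
      unfolding assms(3)[symmetric] by linarith
    then have "w_exp (l - 1) \<zeta> \<noteq> w_exp l \<zeta>" using False ln wl by auto
    moreover have "w_exp (l - 1) \<zeta> \<le> w_exp l \<zeta>" by (rule w_exp_mono) simp
    ultimately show ?thesis by simp
  qed
  have approx: "\<exists>P y. irreducible P \<and> degree P = l \<and> M \<le> ht P \<and> \<bar>ev \<zeta> P\<bar> = ht P powr (- y) \<and> w < y"
    if "ereal w < w_exp n \<zeta>" for w M
    using irreducible_approximant_exponent[OF tr ln(1) less] that by (simp add: wl)
  have "ereal v \<le> min (ereal (real n + real l - 1)) (second_bound n l \<zeta>)"
    if v: "\<forall>\<^sub>F X in at_top. approx_solvable n \<zeta> v X" for v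
  proof -
    have "ereal v \<le> w_hat n \<zeta>" unfolding w_hat_def by (intro Sup_upper) (use v in auto)
    then have vw: "ereal v \<le> w_exp n \<zeta>" using w_hat_le_w_exp[OF assms(1), of \<zeta>] by simp
    have "v \<le> real n + real l - 1"
    proof (cases "order_at_most \<zeta> l (real n + real l - 1)")
      case True
      then have "w_exp l \<zeta> \<le> ereal (real n + real l - 1)"
        using ln by (intro w_exp_le_if_order_at_most) auto
      with vw have "ereal v \<le> ereal (real n + real l - 1)" unfolding wl by (rule order_trans)
      then show ?thesis by simp
    next
      case False
      then show ?thesis by (rule uniform_exponent_le_sum[OF tr assms(1) ln(1) _ v])
    qed
    moreover have "ereal v \<le> second_bound n l \<zeta>"
    proof (cases "w_exp n \<zeta>")
      case PInf
      show ?thesis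
      proof (cases "w_exp (n - l) \<zeta>")
        case PInf': PInf
        then show ?thesis using PInf by (simp add: second_bound_def)
      next
        case MInf
        then show ?thesis using w_exp_nonneg[of "n - l" \<zeta>] by simp
      next
        case (real s)
        have "v \<le> real n + (real l - 1) * 0 + (1 - 0) * s"
        proof (rule uniform_exponent_bound_limit[OF tr ln v real])
          fix \<epsilon> M :: real assume "\<epsilon> > 0"
          define w where "w = max (real n + real l - 1) (n / \<epsilon> + real l)"
          obtain P y where P: "irreducible P" "degree P = l" "M \<le> ht P" "\<bar>ev \<zeta> P\<bar> = ht P powr (- y)" "w < y"
            using approx[of w M] PInf by auto
          have "n / \<epsilon> < y - real l + 1" "0 \<le> n / \<epsilon>"
            using P(5) \<open>\<epsilon> > 0\<close> by (auto simp: w_def)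
          moreover from this have pos: "0 < y - real l + 1" by linarith
          ultimately have "n < \<epsilon> * (y - real l + 1)"
            using \<open>\<epsilon> > 0\<close> by (simp add: pos_divide_less_eq mult.commute)
          then have "n / (y - real l + 1) < \<epsilon>" using pos by (simp only: pos_divide_less_eq)
          moreover have "0 \<le> n / (y - real l + 1)" using pos by simp
          ultimately have "\<bar>n / (y - real l + 1) - 0\<bar> < \<epsilon>" by linarith
          moreover have "real n + real l - 1 \<le> y" using P(5) by (simp add: w_def)
          ultimately show "\<exists>P y. irreducible P \<and> degree P = l \<and> M \<le> ht P \<and>
            \<bar>ev \<zeta> P\<bar> = ht P powr (- y) \<and> real n + real l - 1 \<le> y \<and> \<bar>n / (y - real l + 1) - 0\<bar> < \<epsilon>"
            using P by blast
        qed auto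
        then show ?thesis by (simp add: second_bound_def PInf real)
      qed
    next
      case MInf
      then show ?thesis using wn by simp
    next
      case (real w)
      define u where "u = w - real l + 1"
      have "real n \<le> w" using wn real by simp
      then have u: "0 < u" using ln by (simp add: u_def)
      have "w_exp (n - l) \<zeta> \<le> ereal w" using w_exp_mono[of "n - l" n \<zeta>] real by simp
      then obtain s where s: "w_exp (n - l) \<zeta> = ereal s" "s \<le> w"
        using w_exp_nonneg[of "n - l" \<zeta>] by (cases "w_exp (n - l) \<zeta>") auto
      have sb: "second_bound n l \<zeta> = ereal (n * w / u + s * (1 - n / u))"
        using u by (simp add: second_bound_def real s u_def one_ereal_def)
      show ?thesis
      proof (cases "u \<le> n")
        case True
        \<comment> \<open>here \<open>w \<le> n + l - 1\<close>, and the trivial bound \<open>v \<le> w\<close> is the stronger one\<close>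
        have "n * w / u + s * (1 - n / u) - w = (n - u) * (w - s) / u"
          using u by (simp add: field_simps)
        also have "\<dots> \<ge> 0" using True s(2) u by simp
        finally show ?thesis using vw by (simp add: sb real)
      next
        case False
        define r where "r = n / u"
        have "v \<le> n + (real l - 1) * r + (1 - r) * s"
        proof (rule uniform_exponent_bound_limit[OF tr ln v s(1)])
          show "0 \<le> r" "r < 1" using u False by (auto simp: r_def)
          fix \<epsilon> M :: real assume "\<epsilon> > 0"
          have "((\<lambda>y. n / (y - real l + 1)) \<longlongrightarrow> n / (w - real l + 1)) (at w)"
            using u by (intro tendsto_intros) (auto simp: u_def)
          then have "((\<lambda>y. n / (y - real l + 1)) \<longlongrightarrow> r) (nhds w)"
            by (simp add: tendsto_nhds_iff r_def u_def)
          then have "\<forall>\<^sub>F y in nhds w. dist (n / (y - real l + 1)) r < \<epsilon>"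
            using \<open>\<epsilon> > 0\<close> by (rule tendstoD)
          then obtain \<delta>0 where \<delta>0: "\<delta>0 > 0" "\<And>y. dist y w < \<delta>0 \<Longrightarrow> dist (n / (y - real l + 1)) r < \<epsilon>"
            by (auto simp: eventually_nhds_metric)
          \<comment> \<open>the bound \<open>u - n\<close> keeps \<open>y\<close> above \<open>n + l - 1\<close>\<close>
          define \<delta> where "\<delta> = min \<delta>0 (u - n)"
          have \<delta>: "0 < \<delta>" "\<delta> \<le> \<delta>0" "\<delta> \<le> u - n" using \<delta>0 False by (auto simp: \<delta>_def)
          \<comment> \<open>an upper bound for \<open>y\<close>: exponents beyond \<open>w + \<delta>\<close> occur at bounded heights only\<close>
          have "order_at_most \<zeta> l (w + \<delta> / 2)"
            using \<delta>(1) \<open>real n \<le> w\<close> by (intro order_at_most_if_w_exp_less[OF tr]) (auto simp: wl real)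
          then obtain c where c: "c > 0"
            "\<And>P. P \<noteq> 0 \<Longrightarrow> degree P \<le> l \<Longrightarrow> c * ht P powr (- (w + \<delta> / 2)) \<le> \<bar>ev \<zeta> P\<bar>"
            by (rule order_at_mostE) blast
          have "\<forall>\<^sub>F H in at_top. 1 / c * H powr (- (w + \<delta>)) < H powr (- (w + \<delta> / 2))"
            using \<delta>(1) by (intro powr_eventually_less) auto
          then obtain M' where M': "\<And>H. H \<ge> M' \<Longrightarrow> 1 / c * H powr (- (w + \<delta>)) < H powr (- (w + \<delta> / 2))"
            by (auto simp: eventually_at_top_linorder)
          obtain P y where P: "irreducible P" "degree P = l" "max M (max 2 M') \<le> ht P"
            "\<bar>ev \<zeta> P\<bar> = ht P powr (- y)" "w - \<delta> < y"
            using approx[of "w - \<delta>" "max M (max 2 M')"] \<delta>(1) real by auto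
          have "P \<noteq> 0" using P(1) by auto
          have "ht P powr (- (w + \<delta>)) < c * ht P powr (- (w + \<delta> / 2))"
          proof -
            have "c * (1 / c * ht P powr (- (w + \<delta>))) < c * ht P powr (- (w + \<delta> / 2))"
              using c(1) P(3) by (intro mult_strict_left_mono M') auto
            then show ?thesis using c(1) by simp
          qed
          also have "\<dots> \<le> ht P powr (- y)" using c(2)[OF \<open>P \<noteq> 0\<close>] P(2,4) by simp
          finally have "y < w + \<delta>" using P(3) by simp
          then have "dist y w < \<delta>0" using P(5) \<delta>(2) by (simp add: dist_real_def)
          then have "\<bar>n / (y - real l + 1) - r\<bar> < \<epsilon>" using \<delta>0(2)[of y] by (simp add: dist_real_def)
          moreover have "real n + real l - 1 \<le> y" using P(5) \<delta>(3) by (simp add: u_def)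
          ultimately show "\<exists>P y. irreducible P \<and> degree P = l \<and> M \<le> ht P \<and>
            \<bar>ev \<zeta> P\<bar> = ht P powr (- y) \<and> real n + real l - 1 \<le> y \<and> \<bar>n / (y - real l + 1) - r\<bar> < \<epsilon>"
            using P by auto
        qed
        also have "n + (real l - 1) * r + (1 - r) * s = n * w / u + s * (1 - n / u)"
        proof -
          have "n * w / u = n * (u + (real l - 1)) / u" by (simp add: u_def)
          also have "\<dots> = n + (real l - 1) * r"
            using u by (simp add: r_def distrib_left add_divide_distrib)
          finally show ?thesis by (simp add: r_def mult.commute)
        qed
        finally show ?thesis by (simp add: sb)
      qed
    qed
    ultimately show ?thesis by simp
  qed
  then show ?thesis unfolding w_hat_def by (auto intro!: Sup_least)
qed

end
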